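(* Suppose that every quasi-line graph $G$ satisfying $\chi_l(G) \geq \Delta(G) \geq 9$ contains a complete subgraph on $\Delta(G)$ vertices. Then every claw-free graph $G$ satisfying $\chi_l(G) \geq \Delta(G) \geq 9$ contains a complete subgraph on $\Delta(G)$ vertices.
   Context: Graphs are finite and simple. $\Delta(G)$ is the maximum degree and $\chi_l(G)$ the list chromatic number (choice number) of $G$. A graph is claw-free if it has no induced subgraph isomorphic to $K_{1,3}$. A graph is quasi-line if for every vertex $v$ the neighborhood $N(v)$ can be covered by two cliques. *)

theory Defs
  imports "Graph_Theory.Graph_Theory"
begin

text \<open>
  Finite simple graphs are the \<^locale>\<open>pair_graph\<close>s of the library: a finite vertex set with a finite,
  symmetric, irreflexive set of ordered pairs, so that an undirected edge is a pair of opposite arcs.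
\<close>

definition nbhd :: "'a pair_pre_digraph \<Rightarrow> 'a \<Rightarrow> 'a set" where
  "nbhd G v = {w. (v, w) \<in> parcs G}"

text \<open>Inserting 0 only matters for the null graph, which gets maximum degree 0.\<close>

definition max_degree :: "'a pair_pre_digraph \<Rightarrow> nat" where
  "max_degree G = Max (insert 0 (out_degree G ` pverts G))"

definition clique :: "'a pair_pre_digraph \<Rightarrow> 'a set \<Rightarrow> bool" where
  "clique G C \<longleftrightarrow> C \<subseteq> pverts G \<and> (\<forall>u\<in>C. \<forall>v\<in>C. u \<noteq> v \<longrightarrow> (u, v) \<in> parcs G)"

definition contains_complete :: "nat \<Rightarrow> 'a pair_pre_digraph \<Rightarrow> bool" where
  "contains_complete n G \<longleftrightarrow> (\<exists>H :: 'a pair_pre_digraph. subgraph H G \<and> K\<^bsub>n\<^esub> H)"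

text \<open>
  No induced copy of the claw. Every subgraph of the digraph given by G has the projections
  as tail and head maps, so letting H range over pair digraphs loses nothing.
\<close>

definition claw_free :: "'a pair_pre_digraph \<Rightarrow> bool" where
  "claw_free G \<longleftrightarrow> \<not> (\<exists>H :: 'a pair_pre_digraph. induced_subgraph H G \<and> K\<^bsub>1,3\<^esub> H)"

definition quasi_line :: "'a pair_pre_digraph \<Rightarrow> bool" where
  "quasi_line G \<longleftrightarrow>
     (\<forall>v \<in> pverts G. \<exists>A B. clique G A \<and> clique G B \<and> nbhd G v \<subseteq> A \<union> B)"

definition list_coloring :: "'a pair_pre_digraph \<Rightarrow> ('a \<Rightarrow> 'c set) \<Rightarrow> ('a \<Rightarrow> 'c) \<Rightarrow> bool" where
  "list_coloring G L c \<longleftrightarrow>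
     (\<forall>v \<in> pverts G. c v \<in> L v) \<and> (\<forall>(u, v) \<in> parcs G. c u \<noteq> c v)"

text \<open>
  Colours are natural numbers without loss of generality: on a finite graph, finite lists
  contain only finitely many colours altogether. Finiteness of the lists is explicit because
  infinite sets have cardinality 0 here.
\<close>

definition choosable :: "nat \<Rightarrow> 'a pair_pre_digraph \<Rightarrow> bool" where
  "choosable k G \<longleftrightarrow>
     (\<forall>L :: 'a \<Rightarrow> nat set. (\<forall>v \<in> pverts G. finite (L v) \<and> card (L v) = k) \<longrightarrow>
        (\<exists>c. list_coloring G L c))"

definition list_chromatic_number :: "'a pair_pre_digraph \<Rightarrow> nat" where
  "list_chromatic_number G = (LEAST k. choosable k G)"

text \<open>The least number above is attained.\<close>

lemma ex_injective_choice:
  assumes "finite V" "\<forall>v\<in>V. finite (L v) \<and> card V \<le> card (L v)"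
  shows "\<exists>c. (\<forall>v\<in>V. c v \<in> L v) \<and> inj_on c V"
  using assms
proof (induction V rule: finite_induct)
  case empty
  then show ?case by simp
next
  case (insert x F)
  then have "\<forall>v\<in>F. finite (L v) \<and> card F \<le> card (L v)" by auto
  with insert.IH obtain c where c: "\<forall>v\<in>F. c v \<in> L v" "inj_on c F" by blast
  have "card (c ` F) \<le> card F" by (rule card_image_le[OF insert.hyps(1)])
  also have "\<dots> < card (L x)" using insert by auto
  finally have "\<not> L x \<subseteq> c ` F"
    using card_mono[of "c ` F" "L x"] insert.hyps(1) by auto
  then obtain y where "y \<in> L x" "y \<notin> c ` F" by blast
  then have "(\<forall>v\<in>insert x F. (c(x := y)) v \<in> L v) \<and> inj_on (c(x := y)) (insert x F)"
    using c insert.hyps(2) by (auto simp: inj_on_def)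
  then show ?case by blast
qed

lemma choosable_list_chromatic_number:
  assumes "pair_graph G"
  shows "choosable (list_chromatic_number G) G"
proof -
  interpret pair_graph G by (rule assms)
  have "choosable (card (pverts G)) G"
    unfolding choosable_def
  proof (intro allI impI)
    fix L :: "'a \<Rightarrow> nat set"
    assume "\<forall>v\<in>pverts G. finite (L v) \<and> card (L v) = card (pverts G)"
    then have "\<forall>v\<in>pverts G. finite (L v) \<and> card (pverts G) \<le> card (L v)" by simp
    from ex_injective_choice[OF pair_finite_verts this]
    obtain c where c: "\<forall>v\<in>pverts G. c v \<in> L v" "inj_on c (pverts G)" by blast
    have "c u \<noteq> c v" if "(u, v) \<in> parcs G" for u v
    proof
      assume "c u = c v"
      then have "u = v"
        using inj_onD[OF c(2)] in_arcsD1[OF that] in_arcsD2[OF that] by blast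
      then show False using pair_no_loops[OF that] by simp
    qed
    with c(1) have "list_coloring G L c" unfolding list_coloring_def by blast
    then show "\<exists>c. list_coloring G L c" by blast
  qed
  then show ?thesis unfolding list_chromatic_number_def by (rule LeastI)
qed

lemma contains_complete_iff_clique:
  assumes "pair_graph G"
  shows "contains_complete n G \<longleftrightarrow> (\<exists>C. clique G C \<and> card C = n)"
proof
  interpret pair_graph G by (rule assms)
  show "\<exists>C. clique G C \<and> card C = n" if "contains_complete n G"
  proof -
    from that obtain H :: "'a pair_pre_digraph"
      where "subgraph H G" and "K\<^bsub>n\<^esub> H"
      unfolding contains_complete_def by blast
    then have H: "pverts H \<subseteq> pverts G" "parcs H \<subseteq> parcs G" "card (pverts H) = n"
      "parcs H = {(u, v). (u, v) \<in> pverts H \<times> pverts H \<and> u \<noteq> v}"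
      unfolding complete_digraph_pair_def subgraph_def with_proj_simps by blast+
    have "clique G (pverts H)"
      unfolding clique_def using H(1,2,4) by blast
    with H(3) show ?thesis by blast
  qed
  assume "\<exists>C. clique G C \<and> card C = n"
  then obtain C where C: "clique G C" "card C = n" by blast
  let ?H = "\<lparr>pverts = C, parcs = {(u, v). (u, v) \<in> C \<times> C \<and> u \<noteq> v}\<rparr>"
  have fin: "finite C"
    using C(1) finite_subset[OF _ pair_finite_verts] unfolding clique_def by blast
  have "pair_wf_digraph ?H" by (rule pair_wf_digraph.intro) auto
  then have "wf_digraph (with_proj ?H)" by (simp add: wf_digraph_wp_iff)
  moreover have "C \<subseteq> pverts G" "parcs ?H \<subseteq> parcs G"
    using C(1) by (auto simp: clique_def)
  ultimately have "subgraph ?H G"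
    using wf_digraph_axioms by (simp add: subgraph_def compatible_def)
  moreover have "K\<^bsub>n\<^esub> ?H"
    unfolding complete_digraph_pair_def using C fin by auto
  ultimately show "contains_complete n G" unfolding contains_complete_def by blast
qed

end

theory Submission
  imports Defs "HOL-Library.FuncSet"
begin

text \<open>
  Let \<open>k + 1\<close> be the maximum degree and let \<open>U\<close> be a minimal vertex set that is not colourable from some lists
  of size \<open>k\<close>. Every vertex of \<open>U\<close> has degree \<open>k\<close> or \<open>k + 1\<close> in \<open>U\<close>, and colouring all of \<open>U\<close> outside an
  induced subgraph \<open>J\<close> leaves lists on \<open>J\<close> that are at most one shorter than the degree in \<open>J\<close>. Hence
  \<open>J\<close> is impossible whenever the Alon--Tarsi method colours it from all such lists. If the
  neighbourhood of \<open>v \<in> U\<close> is not covered by two cliques, a shortest odd cycle in its complement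
  yields either the complement of a path on six vertices, which is impossible in this sense, or an
  induced 5-cycle. Extending the 5-wheel vertex by vertex, inside or outside the neighbourhood of \<open>v\<close>,
  always leads to a claw or to one of finitely many impossible subgraphs. So \<open>U\<close> induces a
  quasi-line graph that is not \<open>k\<close>-choosable.
\<close>

section \<open>The Alon--Tarsi method\<close>

text \<open>The weights are the coefficients of a divided difference at the \<open>d + 1\<close>
  points of \<open>A\<close>. For a new node \<open>b\<close>, the old weights are divided by
  \<open>x - b\<close>, and the weight \<open>- s\<close> of \<open>b\<close> itself replaces
  \<open>x ^ j\<close> by \<open>x ^ j - b ^ j\<close>, which is divisible by
  \<open>x - b\<close>.\<close>

lemma moment_weights:
  fixes A :: "'c::field set"
  assumes "finite A" "card A = Suc d"
  shows "\<exists>w. \<forall>j\<le>d. (\<Sum>x\<in>A. w x * x ^ j) = (if j = d then 1 else 0)"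
  using assms
proof (induction d arbitrary: A)
  case 0
  then obtain a where "A = {a}" by (metis One_nat_def card_1_singletonE)
  then show ?case by (intro exI[of _ "\<lambda>_. 1"]) simp
next
  case (Suc d)
  from Suc.prems obtain b B where A: "A = insert b B" "b \<notin> B" "card B = Suc d" "finite B"
    by (metis card_Suc_eq finite_insert)
  with Suc.IH[of B] obtain w
    where w: "\<And>j. j \<le> d \<Longrightarrow> (\<Sum>x\<in>B. w x * x ^ j) = (if j = d then 1 else 0)" by blast
  define s where "s = (\<Sum>x\<in>B. w x / (x - b))"
  define u where "u x = (if x = b then - s else w x / (x - b))" for x
  have "(\<Sum>x\<in>A. u x * x ^ j) = (if j = Suc d then 1 else 0)" if "j \<le> Suc d" for j
  proof -
    have "(\<Sum>x\<in>A. u x * x ^ j) = (\<Sum>x\<in>B. w x / (x - b) * x ^ j) - s * b ^ j"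
      using A by (auto simp: u_def intro!: sum.cong)
    also have "\<dots> = (\<Sum>x\<in>B. w x / (x - b) * (x ^ j - b ^ j))"
      unfolding s_def sum_distrib_right sum_subtractf[symmetric] by (simp add: algebra_simps)
    also have "\<dots> = (\<Sum>x\<in>B. \<Sum>i<j. b ^ (j - Suc i) * (w x * x ^ i))"
    proof (rule sum.cong[OF refl])
      fix x assume "x \<in> B"
      with A have "x - b \<noteq> 0" by auto
      then have "w x / (x - b) * (x ^ j - b ^ j) = w x * (\<Sum>i<j. b ^ (j - Suc i) * x ^ i)"
        by (simp add: power_diff_sumr2)
      then show "w x / (x - b) * (x ^ j - b ^ j) = (\<Sum>i<j. b ^ (j - Suc i) * (w x * x ^ i))"
        by (simp add: sum_distrib_left mult_ac)
    qed
    also have "\<dots> = (\<Sum>i<j. b ^ (j - Suc i) * (\<Sum>x\<in>B. w x * x ^ i))"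
      by (subst sum.swap) (simp add: sum_distrib_left)
    also have "\<dots> = (\<Sum>i<j. if i = d then b ^ (j - Suc i) else 0)"
      using that by (intro sum.cong) (auto simp: w)
    also have "\<dots> = (if j = Suc d then 1 else 0)"
      using that by (auto simp: sum.delta)
    finally show ?thesis .
  qed
  then show ?case by blast
qed

text \<open>The coefficient of \<open>\<Prod>x\<in>V. x ^ d x\<close> in the product of the \<open>x - y\<close> over the edges \<open>(x, y)\<close>.\<close>

primrec ecoef :: "'v set \<Rightarrow> ('v \<times> 'v) list \<Rightarrow> ('v \<Rightarrow> nat) \<Rightarrow> int" where
  "ecoef V [] d = (if \<forall>x\<in>V. d x = 0 then 1 else 0)"
| "ecoef V (e # es) d =
     (if d (fst e) = 0 then 0 else ecoef V es (d(fst e := d (fst e) - 1))) -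
     (if d (snd e) = 0 then 0 else ecoef V es (d(snd e := d (snd e) - 1)))"

text \<open>The weights at \<open>x\<close> annihilate the powers below \<open>D x\<close>. As \<open>D\<close> sums to the number of edges, every
  monomial other than the one with exponents \<open>D\<close> has some exponent that is annihilated.\<close>

lemma weighted_sum_eq_ecoef:
  fixes A :: "'v \<Rightarrow> 'c::field set"
  assumes "finite V" "\<And>x. x \<in> V \<Longrightarrow> finite (A x)"
    and w: "\<And>x j. x \<in> V \<Longrightarrow> j \<le> D x \<Longrightarrow>
              (\<Sum>a\<in>A x. w x a * a ^ j) = (if j = D x then 1 else 0)"
    and "set es \<subseteq> V \<times> V" "(\<Sum>x\<in>V. k x) + length es = (\<Sum>x\<in>V. D x)"
  shows "(\<Sum>f\<in>PiE V A. (\<Prod>x\<in>V. w x (f x) * f x ^ k x) * (\<Prod>e\<leftarrow>es. f (fst e) - f (snd e)))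
     = (if \<forall>x\<in>V. k x \<le> D x then of_int (ecoef V es (\<lambda>x. D x - k x)) else 0)"
  using assms(4,5)
proof (induction es arbitrary: k)
  case Nil
  have "(\<Sum>f\<in>PiE V A. \<Prod>x\<in>V. w x (f x) * f x ^ k x) = (\<Prod>x\<in>V. \<Sum>a\<in>A x. w x a * a ^ k x)"
    using assms(1,2) by (intro prod_sum_PiE[symmetric])
  also have "\<dots> = (if \<forall>x\<in>V. k x = D x then 1 else 0)"
  proof (cases "\<forall>x\<in>V. k x = D x")
    case True
    then show ?thesis by (simp add: w)
  next
    case False
    have "\<exists>x\<in>V. k x < D x"
    proof (rule ccontr)
      assume "\<not> ?thesis"
      then have le: "\<forall>x\<in>V. D x \<le> k x" by auto
      with False obtain y where "y \<in> V" "D y < k y" by (metis le_neq_implies_less)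
      with le assms(1) have "(\<Sum>x\<in>V. D x) < (\<Sum>x\<in>V. k x)" by (intro sum_strict_mono_ex1) auto
      with Nil show False by simp
    qed
    then obtain x where "x \<in> V" "k x < D x" by blast
    then have "(\<Sum>a\<in>A x. w x a * a ^ k x) = 0" using w[of x "k x"] by simp
    with \<open>x \<in> V\<close> have "(\<Prod>x\<in>V. \<Sum>a\<in>A x. w x a * a ^ k x) = 0"
      using assms(1) by (auto intro: prod_zero)
    with False show ?thesis by simp
  qed
  also have "\<dots> = (if \<forall>x\<in>V. k x \<le> D x then of_int (ecoef V [] (\<lambda>x. D x - k x)) else 0)"
    by simp (metis le_antisym)
  finally show ?case by simp
next
  case (Cons e es)
  obtain a b where e: "e = (a, b)" by (cases e)
  with Cons.prems have ab: "a \<in> V" "b \<in> V" by auto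
  \<comment> \<open>\<open>k\<close> holds the exponents collected so far: expanding the factor of
    the edge \<open>(a, b)\<close> raises the exponent of \<open>a\<close> or, with a minus sign,
    that of \<open>b\<close>.\<close>
  define S where "S k = (\<Sum>f\<in>PiE V A. (\<Prod>x\<in>V. w x (f x) * f x ^ k x)
     * (\<Prod>e\<leftarrow>es. f (fst e) - f (snd e)))" for k
  have up: "(\<Prod>x\<in>V. w x (f x) * f x ^ k x) * f y = (\<Prod>x\<in>V. w x (f x) * f x ^ (k(y := Suc (k y))) x)"
    if "y \<in> V" for f y
    using assms(1) that by (simp add: prod.remove[of V y] mult_ac)
  have "(\<Sum>f\<in>PiE V A. (\<Prod>x\<in>V. w x (f x) * f x ^ k x) * (\<Prod>e\<leftarrow>e # es. f (fst e) - f (snd e)))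
     = S (k(a := Suc (k a))) - S (k(b := Suc (k b)))"
    unfolding S_def sum_subtractf[symmetric]
    by (rule sum.cong[OF refl]) (simp add: e up[OF ab(1), symmetric] up[OF ab(2), symmetric] algebra_simps del: fun_upd_apply)
  moreover have step: "S (k(y := Suc (k y))) =
     (if \<forall>x\<in>V. k x \<le> D x then of_int
        (if D y - k y = 0 then 0 else ecoef V es ((\<lambda>x. D x - k x)(y := D y - k y - 1))) else 0)"
    if "y \<in> V" for y
  proof -
    have "(\<Sum>x\<in>V. (k(y := Suc (k y))) x) = Suc (\<Sum>x\<in>V. k x)"
      using assms(1) that by (simp add: sum.remove[of V y])
    then have "S (k(y := Suc (k y))) = (if \<forall>x\<in>V. (k(y := Suc (k y))) x \<le> D x
        then of_int (ecoef V es (\<lambda>x. D x - (k(y := Suc (k y))) x)) else 0)"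
      unfolding S_def using Cons.prems by (intro Cons.IH) auto
    moreover have "(\<lambda>x. D x - (k(y := Suc (k y))) x) = (\<lambda>x. D x - k x)(y := D y - k y - 1)"
      by auto
    moreover have "(\<forall>x\<in>V. (k(y := Suc (k y))) x \<le> D x) \<longleftrightarrow> (\<forall>x\<in>V. k x \<le> D x) \<and> D y - k y \<noteq> 0"
      using that by (auto simp: Suc_le_eq dest: less_imp_le intro: le_neq_implies_less)
    ultimately show ?thesis by auto
  qed
  ultimately show ?case using ab by (simp add: e)
qed

lemma ecoef_eq_0:
  assumes "x \<in> V" "x \<notin> fst ` set es" "x \<notin> snd ` set es" "d x \<noteq> 0"
  shows "ecoef V es d = 0"
  using assms by (induction es arbitrary: d) (auto split: if_splits)

lemma ecoef_insert:
  assumes "x \<notin> fst ` set es" "x \<notin> snd ` set es" "d x = 0"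
  shows "ecoef (insert x V) es d = ecoef V es d"
  using assms by (induction es arbitrary: d) auto

text \<open>A list-based evaluation of \<^const>\<open>ecoef\<close>, one row of the upper triangular adjacency matrix at a
  time: \<open>spread r e ds\<close> lists the ways to choose an endpoint of each edge from the first vertex
  (exponent \<open>e\<close>) to the later ones (exponents \<open>ds\<close>), with sign and remaining exponents.\<close>

fun spread :: "bool list \<Rightarrow> nat \<Rightarrow> nat list \<Rightarrow> (int \<times> nat list) list" where
  "spread [] e ds = (if e = 0 then [(1, [])] else [])"
| "spread (b # r) e [] = []"
| "spread (b # r) e (d # ds) =
     (if b then
        (case e of 0 \<Rightarrow> [] | Suc e' \<Rightarrow> map (\<lambda>(s, l). (s, d # l)) (spread r e' ds)) @
        (case d of 0 \<Rightarrow> [] | Suc d' \<Rightarrow> map (\<lambda>(s, l). (- s, d' # l)) (spread r e ds))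
      else map (\<lambda>(s, l). (s, d # l)) (spread r e ds))"

text \<open>No exponent is tested at the end, because \<open>spread\<close> keeps a choice only if
  it has used up the exponent of the vertex whose row it treats.\<close>

primrec coef :: "bool list list \<Rightarrow> nat list \<Rightarrow> int" where
  "coef [] ds = 1"
| "coef (r # M) ds = (case ds of [] \<Rightarrow> 0
     | e # ds' \<Rightarrow> (\<Sum>(s, l)\<leftarrow>spread r e ds'. s * coef M l))"

text \<open>Turns an exponent list produced by \<open>spread\<close> back into an exponent function,
  so that \<open>coef\<close> can be compared with \<open>ecoef\<close>.\<close>

primrec upds :: "('v \<Rightarrow> nat) \<Rightarrow> 'v list \<Rightarrow> nat list \<Rightarrow> 'v \<Rightarrow> nat" where
  "upds d [] l = d"
| "upds d (y # ys) l = upds (d(y := hd l)) ys (tl l)"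

lemma upds_notin: "x \<notin> set ys \<Longrightarrow> upds d ys l x = d x"
  by (induction ys arbitrary: d l) auto

lemma map_upds: "distinct ys \<Longrightarrow> length l = length ys \<Longrightarrow> map (upds d ys l) ys = l"
  by (induction ys arbitrary: d l) (auto simp: upds_notin length_Suc_conv)

lemma length_spread: "(s, l) \<in> set (spread r e ds) \<Longrightarrow> length ds = length r \<Longrightarrow> length l = length r"
  by (induction r e ds arbitrary: s l rule: spread.induct) (auto split: if_splits nat.splits)

text \<open>An ordered induced subgraph becomes a finite object to compute with. The entry type is
  general because certificates use patterns over \<open>bool option\<close>.\<close>

primrec pattern :: "('v \<Rightarrow> 'v \<Rightarrow> 'b) \<Rightarrow> 'v list \<Rightarrow> 'b list list" where
  "pattern R [] = []"
| "pattern R (x # xs) = map (R x) xs # pattern R xs"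

primrec edges :: "('v \<Rightarrow> 'v \<Rightarrow> bool) \<Rightarrow> 'v list \<Rightarrow> ('v \<times> 'v) list" where
  "edges R [] = []"
| "edges R (x # xs) = map (Pair x) (filter (R x) xs) @ edges R xs"

lemma set_edges: "set (edges R xs) \<subseteq> set xs \<times> set xs"
  by (induction xs) auto

lemma sum_list_uminus: "(\<Sum>x\<leftarrow>xs. - f x) = - (\<Sum>x\<leftarrow>xs. f x :: int)"
  by (induction xs) auto

text \<open>Each edge from \<open>x\<close> lowers the exponent of \<open>x\<close> or, with a minus
  sign, that of its other end; \<open>spread\<close> enumerates these choices. As \<open>x\<close>
  lies on no edge of \<open>es\<close>, only choices that use up its exponent contribute.\<close>

lemma ecoef_row:
  assumes "distinct (x # ys)" "x \<in> V" "x \<notin> fst ` set es" "x \<notin> snd ` set es"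
  shows "ecoef V (map (Pair x) (filter (R x) ys) @ es) d =
     (\<Sum>(s, l)\<leftarrow>spread (map (R x) ys) (d x) (map d ys). s * ecoef V es (upds (d(x := 0)) ys l))"
  using assms(1)
proof (induction ys arbitrary: d)
  case Nil
  show ?case
    by (cases "d x = 0") (use assms ecoef_eq_0[of x V es d] in \<open>auto simp: fun_upd_idem\<close>)
next
  case (Cons y ys)
  let ?S = "\<lambda>d. (\<Sum>(s, l)\<leftarrow>spread (map (R x) ys) (d x) (map d ys). s * ecoef V es (upds (d(x := 0)) ys l))"
  have IH: "ecoef V (map (Pair x) (filter (R x) ys) @ es) d = ?S d" for d
    by (rule Cons.IH) (use Cons.prems in auto)
  from Cons.prems have ne: "x \<noteq> y" "x \<notin> set ys" "y \<notin> set ys" by auto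
  have map_upd: "map (d(z := n)) ys = map d ys" if "z \<notin> set ys" for z n
    using that by auto
  have idem: "(d(x := 0))(y := d y) = d(x := 0)"
    using ne by (intro fun_upd_idem) simp
  have x: "ecoef V (map (Pair x) (filter (R x) ys) @ es) (d(x := n)) =
      (\<Sum>(s, l)\<leftarrow>spread (map (R x) ys) n (map d ys).
         s * ecoef V es (upds ((d(x := 0))(y := d y)) ys l))" for n
    unfolding IH idem using ne by (simp add: map_upd)
  have y: "ecoef V (map (Pair x) (filter (R x) ys) @ es) (d(y := n)) =
      (\<Sum>(s, l)\<leftarrow>spread (map (R x) ys) (d x) (map d ys).
         s * ecoef V es (upds ((d(x := 0))(y := n)) ys l))" for n
    unfolding IH using ne by (simp add: map_upd fun_upd_twist[of x y])
  have "ecoef V (map (Pair x) (filter (R x) ys) @ es) d =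
      (\<Sum>(s, l)\<leftarrow>spread (map (R x) ys) (d x) (map d ys).
         s * ecoef V es (upds ((d(x := 0))(y := d y)) ys l))"
    using x[of "d x"] by (simp only: fun_upd_triv)
  with ne show ?case
    by (cases "d x"; cases "d y")
       (simp_all add: x y o_def case_prod_unfold sum_list_uminus del: fun_upd_apply)
qed

lemma coef_eq_ecoef:
  "distinct xs \<Longrightarrow> coef (pattern R xs) (map d xs) = ecoef (set xs) (edges R xs) d"
proof (induction xs arbitrary: d)
  case (Cons x xs)
  have x: "x \<notin> fst ` set (edges R xs)" "x \<notin> snd ` set (edges R xs)"
    using Cons.prems set_edges[of R xs] by auto
  have "coef (pattern R xs) l = ecoef (set (x # xs)) (edges R xs) (upds (d(x := 0)) xs l)"
    if "length l = length xs" for l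
  proof -
    have "coef (pattern R xs) l = coef (pattern R xs) (map (upds (d(x := 0)) xs l) xs)"
      using that Cons.prems by (simp add: map_upds)
    also have "\<dots> = ecoef (set xs) (edges R xs) (upds (d(x := 0)) xs l)"
      using Cons by simp
    finally show ?thesis
      using x Cons.prems by (simp add: ecoef_insert upds_notin)
  qed
  then have "(\<Sum>(s, l)\<leftarrow>spread (map (R x) xs) (d x) (map d xs). s * coef (pattern R xs) l) =
     (\<Sum>(s, l)\<leftarrow>spread (map (R x) xs) (d x) (map d xs).
        s * ecoef (set (x # xs)) (edges R xs) (upds (d(x := 0)) xs l))"
    by (intro arg_cong[where f = sum_list] map_cong) (auto dest!: length_spread)
  then show ?case
    using Cons.prems x by (simp add: ecoef_row)
qed simp

text \<open>Lists cut down to \<open>d x + 1\<close> colours and embedded into the reals carry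
  weights under which the edge product sums to the coefficient. As this is not 0, some assignment
  makes every factor \<open>f x - f y\<close> nonzero.\<close>

lemma alon_tarsi:
  fixes A :: "'v \<Rightarrow> nat set"
  assumes "distinct xs" "coef (pattern R xs) (map d xs) \<noteq> 0"
    and "length (edges R xs) = sum_list (map d xs)"
    and "\<And>x. x \<in> set xs \<Longrightarrow> finite (A x) \<and> d x < card (A x)"
  shows "\<exists>f. (\<forall>x\<in>set xs. f x \<in> A x) \<and> (\<forall>(x, y)\<in>set (edges R xs). f x \<noteq> f y)"
proof -
  have "\<exists>B \<subseteq> A x. card B = Suc (d x)" if "x \<in> set xs" for x
    using assms(4)[OF that] by (metis Suc_leI obtain_subset_with_card_n)
  then obtain B where B: "\<And>x. x \<in> set xs \<Longrightarrow> B x \<subseteq> A x \<and> card (B x) = Suc (d x)" by metis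
  then have fin: "finite (B x)" if "x \<in> set xs" for x
    using assms(4) that finite_subset by blast
  define C :: "'v \<Rightarrow> real set" where "C x = of_nat ` B x" for x
  have "\<exists>w. \<forall>j\<le>d x. (\<Sum>a\<in>C x. w a * a ^ j) = (if j = d x then 1 else 0)" if "x \<in> set xs" for x
    using B[OF that] fin[OF that] by (intro moment_weights) (auto simp: C_def card_image inj_on_def)
  then obtain w where w: "\<And>x j. x \<in> set xs \<Longrightarrow> j \<le> d x \<Longrightarrow>
      (\<Sum>a\<in>C x. w x a * a ^ j) = (if j = d x then 1 else 0)" by metis
  have "(\<Sum>f\<in>PiE (set xs) C. (\<Prod>x\<in>set xs. w x (f x) * f x ^ 0) *
      (\<Prod>e\<leftarrow>edges R xs. f (fst e) - f (snd e))) = of_int (ecoef (set xs) (edges R xs) (\<lambda>x. d x - 0))"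
    by (subst weighted_sum_eq_ecoef[where D = d])
       (use assms set_edges w fin in \<open>auto simp: C_def sum_list_distinct_conv_sum_set\<close>)
  also have "\<dots> \<noteq> 0" using assms by (simp add: coef_eq_ecoef)
  finally obtain f where f: "f \<in> PiE (set xs) C"
      "(\<Prod>x\<in>set xs. w x (f x) * f x ^ 0) * (\<Prod>e\<leftarrow>edges R xs. f (fst e) - f (snd e)) \<noteq> 0"
    by (meson sum.not_neutral_contains_not_neutral)
  have "\<exists>n. n \<in> A x \<and> f x = of_nat n" if "x \<in> set xs" for x
    using f(1) B[OF that] that unfolding C_def by (auto dest!: PiE_mem)
  then obtain g where g: "\<And>x. x \<in> set xs \<Longrightarrow> g x \<in> A x \<and> f x = of_nat (g x)" by metis
  have "g x \<noteq> g y" if "(x, y) \<in> set (edges R xs)" for x y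
  proof
    assume "g x = g y"
    then have "f x - f y = 0" using that set_edges[of R xs] g by auto
    then have "(\<Prod>e\<leftarrow>edges R xs. f (fst e) - f (snd e)) = 0"
      using that by (auto simp: prod_list_zero_iff image_iff intro!: bexI[of _ "(x, y)"])
    with f(2) show False by simp
  qed
  with g show ?thesis by blast
qed

section \<open>Forbidden patterns in list-critical graphs\<close>

text \<open>A pattern records nonedges too, so this excludes induced copies; all orderings
  \<open>xs\<close> are tried to cover every numbering of the vertices.\<close>

definition avoids :: "'v set \<Rightarrow> ('v \<Rightarrow> 'v \<Rightarrow> bool) \<Rightarrow> bool list list \<Rightarrow> bool" where
  "avoids U R M \<longleftrightarrow> (\<forall>xs. distinct xs \<longrightarrow> set xs \<subseteq> U \<longrightarrow> pattern R xs \<noteq> M)"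

text \<open>The value on the diagonal is meaningless; its uses keep the two indices
  distinct.\<close>

definition entry :: "bool list list \<Rightarrow> nat \<Rightarrow> nat \<Rightarrow> bool" where
  "entry M i j = (if i < j then M ! i ! (j - Suc i) else M ! j ! (i - Suc j))"

lemma length_pattern [simp]: "length (pattern R xs) = length xs"
  by (induction xs) auto

lemma pattern_nth:
  "i < j \<Longrightarrow> j < length xs \<Longrightarrow> pattern R xs ! i ! (j - Suc i) = R (xs ! i) (xs ! j)"
proof (induction xs arbitrary: i j)
  case (Cons x xs)
  then obtain j' where j: "j = Suc j'" by (cases j) auto
  show ?case
    using Cons by (cases i) (auto simp: j)
qed simp

lemma entry_pattern:
  assumes "\<And>x y. R x y = R y x" "i \<noteq> j" "i < length xs" "j < length xs"
  shows "entry (pattern R xs) i j = R (xs ! i) (xs ! j)"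
  using assms by (auto simp: entry_def pattern_nth)

text \<open>Serves the leaves of certificates, where all entries of the named copy are known: an
  adjacency relation agreeing with them realizes the pattern.\<close>

lemma pattern_cong_Some:
  assumes "pattern Q vs = map (map Some) N" "distinct vs"
    and "\<And>i j c. i \<in> set vs \<Longrightarrow> j \<in> set vs \<Longrightarrow> i \<noteq> j \<Longrightarrow> Q i j = Some c \<Longrightarrow> S i j = c"
  shows "pattern S vs = N"
  using assms
proof (induction vs arbitrary: N)
  case (Cons v vs)
  from Cons.prems(1) obtain r N' where N: "N = r # N'" "map (Q v) vs = map Some r"
      "pattern Q vs = map (map Some) N'"
    by auto
  have "map (S v) vs = r"
  proof (rule nth_equalityI)
    show "length (map (S v) vs) = length r" using N(2) by (metis length_map)
    fix i assume i: "i < length (map (S v) vs)"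
    then have "Q v (vs ! i) = Some (r ! i)"
      using N(2) by (metis length_map nth_map)
    then show "map (S v) vs ! i = r ! i"
      using Cons.prems(2) i by (auto intro!: Cons.prems(3))
  qed
  moreover have "pattern S vs = N'"
    using N(3) Cons.prems by (intro Cons.IH) auto
  ultimately show ?case by (simp add: N(1))
qed simp

lemma pattern_map: "pattern R (map f vs) = pattern (\<lambda>i j. R (f i) (f j)) vs"
  by (induction vs) auto

text \<open>A decision tree on the neighbours of a vertex \<open>y\<close> that is added in front of a pattern \<open>M\<close>:
  \<open>Branch i\<close> asks whether \<open>y\<close> is adjacent to vertex \<open>i\<close> of \<open>M\<close>, and \<open>Leaf vs\<close> names an induced copy
  of a forbidden pattern. In \<open>vs\<close>, index 0 is \<open>y\<close> and index \<open>i + 1\<close> is vertex \<open>i\<close> of \<open>M\<close>.\<close>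

datatype cert = Leaf "nat list" | Branch nat cert cert

definition extended_entry :: "bool option list \<Rightarrow> bool list list \<Rightarrow> nat \<Rightarrow> nat \<Rightarrow> bool option" where
  "extended_entry b M i j =
     (case i of 0 \<Rightarrow> (case j of 0 \<Rightarrow> None | Suc j' \<Rightarrow> b ! j')
      | Suc i' \<Rightarrow> (case j of 0 \<Rightarrow> b ! i' | Suc j' \<Rightarrow> Some (entry M i' j')))"

primrec certifies :: "bool list list list \<Rightarrow> bool list list \<Rightarrow> bool option list \<Rightarrow> cert \<Rightarrow> bool" where
  "certifies Ns M b (Leaf vs) \<longleftrightarrow>
     distinct vs \<and> list_all (\<lambda>i. i \<le> length b) vs \<and>
     list_ex (\<lambda>N. pattern (extended_entry b M) vs = map (map Some) N) Ns"
| "certifies Ns M b (Branch i t f) \<longleftrightarrow>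
     certifies Ns M (b[i := Some True]) t \<and> certifies Ns M (b[i := Some False]) f"

text \<open>Descend the tree along the true adjacencies of \<open>y\<close>. The entries recorded in
  \<open>b\<close> stay correct, and the leaf reached exhibits a copy of a pattern that
  \<open>U\<close> avoids.\<close>

lemma certifies_sound:
  assumes "certifies Ns M b t" "list_all (avoids U R) Ns" "\<And>x y. R x y = R y x"
    and "distinct (y # xs)" "set (y # xs) \<subseteq> U" "pattern R xs = M" "length b = length xs"
    and "\<And>i c. i < length b \<Longrightarrow> b ! i = Some c \<Longrightarrow> R y (xs ! i) = c"
  shows False
  using assms(1,7,8)
proof (induction t arbitrary: b)
  case (Leaf vs)
  then obtain N where N: "N \<in> set Ns" "pattern (extended_entry b M) vs = map (map Some) N"
    and vs: "distinct vs" "\<And>i. i \<in> set vs \<Longrightarrow> i \<le> length xs"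
    by (auto simp: list_ex_iff list_all_iff)
  let ?zs = "map ((!) (y # xs)) vs"
  have "R ((y # xs) ! i) ((y # xs) ! j) = c"
    if ij: "i \<in> set vs" "j \<in> set vs" "i \<noteq> j" and e: "extended_entry b M i j = Some c" for i j c
  proof -
    have R: "entry M i' j' = R (xs ! i') (xs ! j')"
      if "i' < length xs" "j' < length xs" "i' \<noteq> j'" for i' j'
      using entry_pattern[of R i' j' xs] assms(3,6) that by auto
    show ?thesis
      using ij e vs(2)[OF ij(1)] vs(2)[OF ij(2)] Leaf.prems(2,3) assms(3) R
      by (auto simp: extended_entry_def Suc_le_eq split: nat.splits)
  qed
  then have "pattern R ?zs = N"
    unfolding pattern_map by (intro pattern_cong_Some[OF N(2) vs(1)]) auto
  moreover have "distinct ?zs"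
    using vs assms(4) by (auto simp: distinct_map inj_on_def nth_eq_iff_index_eq less_Suc_eq_le simp del: distinct.simps)
  moreover have "(y # xs) ! i \<in> U" if "i \<in> set vs" for i
    using vs(2)[OF that] assms(5) nth_mem[of i "y # xs"] by auto
  then have "set ?zs \<subseteq> U" by auto
  ultimately show False
    using assms(2) N(1) unfolding avoids_def list_all_iff by blast
next
  case (Branch i t f)
  let ?b = "b[i := Some (R y (xs ! i))]"
  have b: "R y (xs ! j) = c" if "j < length ?b" "?b ! j = Some c" for j c
    using that Branch.prems(3) by (cases "i = j") auto
  show False
  proof (cases "R y (xs ! i)")
    case True
    with b Branch.prems show False by (intro Branch.IH(1)[of ?b]) auto
  next
    case False
    with b Branch.prems show False by (intro Branch.IH(2)[of ?b]) auto
  qed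
qed

section \<open>Degrees and reducible patterns\<close>

primrec degrees :: "bool list list \<Rightarrow> nat list" where
  "degrees [] = []"
| "degrees (r # M) = length (filter id r) # map2 (\<lambda>b d. if b then Suc d else d) r (degrees M)"

lemma degrees_pattern:
  assumes "\<And>x y. R x y = R y x" "\<And>x. \<not> R x x"
  shows "distinct xs \<Longrightarrow> degrees (pattern R xs) = map (\<lambda>x. card {y \<in> set xs. R x y}) xs"
proof (induction xs)
  case (Cons x xs)
  have "card {y \<in> set (x # xs). R x y} = length (filter id (map (R x) xs))"
  proof -
    have "{y \<in> set (x # xs). R x y} = set (filter (R x) xs)" using assms by auto
    moreover have "distinct (filter (R x) xs)" using Cons.prems by simp
    ultimately have "card {y \<in> set (x # xs). R x y} = length (filter (R x) xs)"
      by (metis distinct_card)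
    then show ?thesis by (simp add: filter_map o_def)
  qed
  moreover have "card {y \<in> set (x # xs). R z y} =
      (if R x z then Suc (card {y \<in> set xs. R z y}) else card {y \<in> set xs. R z y})" for z
  proof -
    have "{y \<in> set (x # xs). R z y} = (if R x z then insert x {y \<in> set xs. R z y} else {y \<in> set xs. R z y})"
      using assms by auto
    then show ?thesis using Cons.prems by simp
  qed
  ultimately show ?case
    using Cons by (simp add: map2_map_map)
qed simp

text \<open>Residual lists in a critical set have at least degree minus one colours, and a vertex
  with exponent \<open>e\<close> needs \<open>e + 1\<close> of them, whence
  \<open>e + 2 \<le> d\<close>. The empty pattern is excluded because it occurs in every
  set.\<close>

definition alon_tarsi_reducible :: "bool list list \<Rightarrow> nat list \<Rightarrow> bool" where
  "alon_tarsi_reducible M ds \<longleftrightarrow> M \<noteq> [] \<and> length ds = length M \<and>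
     list_all2 (\<lambda>e d. e + 2 \<le> d) ds (degrees M) \<and>
     sum_list ds = sum_list (map (\<lambda>r. length (filter id r)) M) \<and> coef M ds \<noteq> 0"

lemma length_edges: "length (edges R xs) = sum_list (map (\<lambda>r. length (filter id r)) (pattern R xs))"
  by (induction xs) (auto simp: filter_map o_def)

lemma edges_cover:
  assumes "\<And>x y. R x y = R y x" "\<And>x. \<not> R x x"
  shows "x \<in> set xs \<Longrightarrow> y \<in> set xs \<Longrightarrow> R x y \<Longrightarrow> (x, y) \<in> set (edges R xs) \<or> (y, x) \<in> set (edges R xs)"
  using assms by (induction xs) auto

section \<open>Critical vertex sets and residual lists\<close>

definition proper :: "('v \<Rightarrow> 'v \<Rightarrow> bool) \<Rightarrow> 'v set \<Rightarrow> ('v \<Rightarrow> nat set) \<Rightarrow> ('v \<Rightarrow> nat) \<Rightarrow> bool" where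
  "proper R W L c \<longleftrightarrow> (\<forall>x\<in>W. c x \<in> L x \<and> (\<forall>y\<in>W. R x y \<longrightarrow> c x \<noteq> c y))"

text \<open>Criticality refers to one fixed list assignment \<open>L\<close>: smaller sets are
  colourable from the same lists.\<close>

locale list_critical =
  fixes U :: "'v set" and R :: "'v \<Rightarrow> 'v \<Rightarrow> bool" and L :: "'v \<Rightarrow> nat set" and k :: nat
  assumes finite_U: "finite U"
    and sym: "R x y = R y x"
    and irrefl: "\<not> R x x"
    and degree_le: "x \<in> U \<Longrightarrow> card {y \<in> U. R x y} \<le> Suc k"
    and lists: "x \<in> U \<Longrightarrow> finite (L x) \<and> card (L x) = k"
    and not_colorable: "\<not> proper R U L c"
    and critical: "W \<subset> U \<Longrightarrow> \<exists>c. proper R W L c"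
begin

text \<open>Colour \<open>U - W\<close> by criticality and delete from each list the colours of the
  neighbours outside \<open>W\<close>. A colouring of \<open>W\<close> from what remains would
  extend to \<open>U\<close>. The bound is an inequality of sums to avoid truncated
  subtraction.\<close>

lemma residual_lists:
  assumes "W \<subseteq> U" "W \<noteq> {}"
  shows "\<exists>L'. (\<forall>x\<in>W. finite (L' x) \<and>
            k + card {y \<in> W. R x y} \<le> card (L' x) + card {y \<in> U. R x y}) \<and>
          (\<forall>c. \<not> proper R W L' c)"
proof -
  from assms have "U - W \<subset> U" by auto
  from critical[OF this] obtain c where c: "proper R (U - W) L c" ..
  define L' where "L' x = L x - c ` {y \<in> U - W. R x y}" for x
  have fin: "finite (L' x)" if "x \<in> W" for x
    using that assms lists by (auto simp: L'_def)
  have size: "k + card {y \<in> W. R x y} \<le> card (L' x) + card {y \<in> U. R x y}" if x: "x \<in> W" for x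
  proof -
    have finN: "finite {y \<in> U - W. R x y}" "finite {y \<in> W. R x y}"
      using finite_U assms(1) finite_subset[of W U] by auto
    have "{y \<in> U. R x y} = {y \<in> U - W. R x y} \<union> {y \<in> W. R x y}" using assms(1) by auto
    then have "card {y \<in> U. R x y} = card {y \<in> U - W. R x y} + card {y \<in> W. R x y}"
      using finN by (simp add: card_Un_disjoint disjoint_iff)
    moreover have "card (L x) - card (c ` {y \<in> U - W. R x y}) \<le> card (L' x)"
      unfolding L'_def by (rule diff_card_le_card_Diff[OF finite_imageI[OF finN(1)]])
    moreover have "card (L x) = k" using lists x assms(1) by blast
    moreover have "card (c ` {y \<in> U - W. R x y}) \<le> card {y \<in> U - W. R x y}"
      using finN(1) by (rule card_image_le)
    ultimately show ?thesis by linarith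
  qed
  have no: "\<not> proper R W L' c'" for c'
  proof
    assume c': "proper R W L' c'"
    let ?f = "\<lambda>x. if x \<in> W then c' x else c x"
    have mem: "?f x \<in> L x" if "x \<in> U" for x
      using c c' that by (simp add: proper_def L'_def)
    have 1: "c' x \<noteq> c' y" if "x \<in> W" "y \<in> W" "R x y" for x y
      using c' that by (simp add: proper_def)
    have 2: "c x \<noteq> c y" if "x \<in> U - W" "y \<in> U - W" "R x y" for x y
      using c that by (simp add: proper_def)
    have 3: "c' x \<noteq> c y" if "x \<in> W" "y \<in> U - W" "R x y" for x y
    proof -
      have "c' x \<in> L' x" using c' that(1) by (simp add: proper_def)
      then show ?thesis using that(2,3) unfolding L'_def by blast
    qed
    have "?f x \<noteq> ?f y" if "x \<in> U" "y \<in> U" "R x y" for x y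
      using that 1[of x y] 2[of x y] 3[of x y] 3[of y x] sym[of x y]
      by (cases "x \<in> W"; cases "y \<in> W") auto
    with mem have "proper R U L ?f" unfolding proper_def by blast
    then show False using not_colorable by blast
  qed
  show ?thesis using fin size no by (intro exI[of _ L']) simp
qed

text \<open>The residual list of a single vertex must be empty, so its neighbours use up all
  \<open>k\<close> colours.\<close>

lemma degree_ge:
  assumes "x \<in> U"
  shows "k \<le> card {y \<in> U. R x y}"
proof -
  obtain L' where L': "k + card {y \<in> {x}. R x y} \<le> card (L' x) + card {y \<in> U. R x y}"
    "\<And>c. \<not> proper R {x} L' c"
    using residual_lists[of "{x}"] assms by auto
  have "L' x = {}"
  proof (rule ccontr)
    assume "L' x \<noteq> {}"
    then obtain a where "a \<in> L' x" by blast
    then have "proper R {x} L' (\<lambda>_. a)" by (simp add: proper_def irrefl)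
    with L'(2) show False by blast
  qed
  with L'(1) show ?thesis by simp
qed

text \<open>On an induced copy the residual lists are longer than the exponents \<open>ds\<close>,
  so \<open>alon_tarsi\<close> would colour it.\<close>

lemma avoids_if_alon_tarsi_reducible:
  assumes "alon_tarsi_reducible M ds"
  shows "avoids U R M"
  unfolding avoids_def
proof (intro allI impI notI)
  fix xs assume xs: "distinct xs" "set xs \<subseteq> U" and M: "pattern R xs = M"
  have at: "xs \<noteq> []" "length ds = length xs" "coef (pattern R xs) ds \<noteq> 0"
      "list_all2 (\<lambda>e d. e + 2 \<le> d) ds (degrees (pattern R xs))"
      "sum_list ds = length (edges R xs)"
    using assms by (auto simp: alon_tarsi_reducible_def M[symmetric] length_edges)
  define d where "d = upds (\<lambda>_. 0) xs ds"
  have d: "map d xs = ds" using at(2) xs(1) by (simp add: d_def map_upds)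
  from at(1) have "set xs \<noteq> {}" by simp
  then obtain L' where
    "\<forall>x\<in>set xs. finite (L' x) \<and> k + card {y \<in> set xs. R x y} \<le> card (L' x) + card {y \<in> U. R x y}"
    and no: "\<forall>c. \<not> proper R (set xs) L' c"
    using residual_lists[OF xs(2)] by blast
  then have L': "finite (L' x)" "k + card {y \<in> set xs. R x y} \<le> card (L' x) + card {y \<in> U. R x y}"
    if "x \<in> set xs" for x
    using that by auto
  have "degrees (pattern R xs) = map (\<lambda>x. card {y \<in> set xs. R x y}) xs"
    by (rule degrees_pattern[OF sym irrefl xs(1)])
  with at(4) have "list_all2 (\<lambda>e d. e + 2 \<le> d) (map d xs) (map (\<lambda>x. card {y \<in> set xs. R x y}) xs)"
    by (simp only: d)
  then have deg: "d x + 2 \<le> card {y \<in> set xs. R x y}" if "x \<in> set xs" for x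
    using that by (simp add: list.rel_map list_all2_same)
  have "finite (L' x) \<and> d x < card (L' x)" if "x \<in> set xs" for x
  proof -
    have "x \<in> U" using xs(2) that by blast
    from degree_le[OF this] show ?thesis using deg[OF that] L'(1,2)[OF that] by linarith
  qed
  then have "\<exists>f. (\<forall>x\<in>set xs. f x \<in> L' x) \<and> (\<forall>(x, y)\<in>set (edges R xs). f x \<noteq> f y)"
    by (intro alon_tarsi[OF xs(1), of R d L']) (simp_all only: d at not_False_eq_True)
  then obtain f where f: "\<forall>x\<in>set xs. f x \<in> L' x" "\<forall>(x, y)\<in>set (edges R xs). f x \<noteq> f y"
    by blast
  have "f x \<noteq> f y" if "x \<in> set xs" "y \<in> set xs" "R x y" for x y
  proof -
    have "(x, y) \<in> set (edges R xs) \<or> (y, x) \<in> set (edges R xs)"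
      by (rule edges_cover[of R, OF sym irrefl that])
    then show ?thesis using f(2) by auto
  qed
  with f(1) have "proper R (set xs) L' f" by (simp add: proper_def)
  then show False using no by blast
qed

end

section \<open>Claws and extensions by one vertex\<close>

definition claw_pattern :: "bool list list" where
  "claw_pattern = [[True, True, True], [False, False], [False], []]"

text \<open>The last vertex of a pattern is always the centre \<open>v\<close>. An inner extension adds another neighbour of
  \<open>v\<close>, which exists since \<open>v\<close> has at least 8 of them. An outer extension adds a neighbour of
  \<open>a\<close> outside the closed neighbourhood of \<open>v\<close>, which exists since \<open>a\<close> has two nonneighbours among the
  at most \<open>k + 1\<close> neighbours of \<open>v\<close> but at least \<open>k\<close> neighbours in all.\<close>

definition inner_row :: "bool list list \<Rightarrow> bool option list" where
  "inner_row M = replicate (length M - 1) None @ [Some True]"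

definition outer_row :: "nat \<Rightarrow> bool list list \<Rightarrow> bool option list" where
  "outer_row a M = (replicate (length M - 1) None)[a := Some True] @ [Some False]"

definition inner_ok :: "bool list list \<Rightarrow> bool" where
  "inner_ok M \<longleftrightarrow> M \<noteq> [] \<and>
     length (filter (\<lambda>i. entry M (length M - 1) i) [0..<length M - 1]) < 8"

text \<open>By the last condition, neighbours of \<open>a\<close> in the pattern are neighbours of
  the centre, so a neighbour of \<open>a\<close> outside its closed neighbourhood is a new
  vertex.\<close>

definition outer_ok :: "nat \<Rightarrow> bool list list \<Rightarrow> bool" where
  "outer_ok a M \<longleftrightarrow> (let n = length M - 1 in a < n \<and> entry M n a \<and>
     2 \<le> length (filter (\<lambda>i. i \<noteq> a \<and> entry M n i \<and> \<not> entry M a i) [0..<n]) \<and>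
     list_all (\<lambda>i. i \<noteq> a \<longrightarrow> entry M a i \<longrightarrow> entry M n i) [0..<n])"

locale claw_free_list_critical = list_critical +
  assumes claw_free: "\<lbrakk>x \<in> U; a \<in> U; b \<in> U; c \<in> U; R x a; R x b; R x c; distinct [a, b, c]\<rbrakk>
      \<Longrightarrow> R a b \<or> R a c \<or> R b c"
    and k_ge: "8 \<le> k"
begin

lemma avoids_claw: "avoids U R claw_pattern"
  unfolding avoids_def
proof (intro allI impI notI)
  fix xs assume xs: "distinct xs" "set xs \<subseteq> U" and M: "pattern R xs = claw_pattern"
  from arg_cong[OF M, of length] have "length xs = 4" by (simp add: claw_pattern_def)
  then obtain x a b c where "xs = [x, a, b, c]"
    by (auto simp: length_Suc_conv eval_nat_numeral)
  with xs M claw_free[of x a b c] show False by (auto simp: claw_pattern_def)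
qed

text \<open>Reduces degree counts to counts of indices, which can be evaluated on the pattern
  alone.\<close>

lemma card_indices:
  assumes "distinct xs" "n \<le> length xs"
  shows "card {y \<in> set (take n xs). P y} = length (filter (\<lambda>i. P (xs ! i)) [0..<n])"
proof -
  have "{y \<in> set (take n xs). P y} = (!) xs ` {i. i < n \<and> P (xs ! i)}"
    using assms(2) by (auto simp: in_set_conv_nth intro!: image_eqI)
  moreover have "inj_on ((!) xs) {i. i < n \<and> P (xs ! i)}"
    using assms by (auto simp: inj_on_def nth_eq_iff_index_eq)
  moreover have "card {i. i < n \<and> P (xs ! i)} = length (filter (\<lambda>i. P (xs ! i)) [0..<n])"
    by (subst distinct_card[symmetric]) (auto intro!: arg_cong[where f = card])
  ultimately show ?thesis by (simp add: card_image)
qed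

lemma avoids_inner:
  assumes "inner_ok M" "list_all (avoids U R) Ns" "certifies Ns M (inner_row M) t"
  shows "avoids U R M"
  unfolding avoids_def
proof (intro allI impI notI)
  fix xs assume xs: "distinct xs" "set xs \<subseteq> U" and M: "pattern R xs = M"
  define n where "n = length xs - 1"
  have len: "length M = length xs" using M by auto
  with assms(1) have n: "length xs = Suc n" by (cases xs) (auto simp: inner_ok_def n_def)
  let ?v = "xs ! n"
  have v: "?v \<in> U" using xs n by (metis lessI nth_mem subsetD)
  have "xs = take n xs @ [?v]" using n by (metis lessI take_Suc_conv_app_nth take_all_iff order_refl)
  from arg_cong[OF this, of set] have set: "set xs = insert ?v (set (take n xs))" by simp
  have "filter (\<lambda>i. R ?v (xs ! i)) [0..<n] = filter (\<lambda>i. entry M n i) [0..<n]"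
    using n sym entry_pattern[of R n _ xs] M by (intro filter_cong) auto
  then have "card {y \<in> set (take n xs). R ?v y} < 8"
    using card_indices[of xs n "R ?v"] xs(1) n assms(1) len by (simp add: inner_ok_def)
  moreover have "{y \<in> set xs. R ?v y} = {y \<in> set (take n xs). R ?v y}"
    unfolding set using irrefl by auto
  ultimately have "card {y \<in> set xs. R ?v y} < card {y \<in> U. R ?v y}"
    using degree_ge[OF v] k_ge by simp
  then have "\<not> {y \<in> U. R ?v y} \<subseteq> {y \<in> set xs. R ?v y}"
    using card_mono[of "{y \<in> set xs. R ?v y}" "{y \<in> U. R ?v y}"] by auto
  then obtain y where y: "y \<in> U" "R ?v y" "y \<notin> set xs" by blast
  show False
  proof (rule certifies_sound[OF assms(3,2)])
    show "R x y = R y x" for x y by (rule sym)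
    show "distinct (y # xs)" "set (y # xs) \<subseteq> U" "pattern R xs = M" using xs y M by auto
    show "length (inner_row M) = length xs" by (simp add: inner_row_def len n)
    fix i c assume "i < length (inner_row M)" "inner_row M ! i = Some c"
    then have "i = n" "c" by (auto simp: inner_row_def len n nth_append split: if_splits)
    then show "R y (xs ! i) = c" using y(2) sym by auto
  qed
qed

lemma avoids_outer:
  assumes "outer_ok a M" "list_all (avoids U R) Ns" "certifies Ns M (outer_row a M) t"
  shows "avoids U R M"
  unfolding avoids_def
proof (intro allI impI notI)
  fix xs assume xs: "distinct xs" "set xs \<subseteq> U" and M: "pattern R xs = M"
  define n where "n = length xs - 1"
  have len: "length M = length xs" using M by auto
  have a: "a < n" using assms(1) len by (auto simp: outer_ok_def n_def Let_def)
  then have n: "length xs = Suc n" by (auto simp: n_def)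
  let ?v = "xs ! n" and ?a = "xs ! a"
  have v: "?v \<in> U" "?a \<in> U" using xs n a by (auto simp: subset_iff)
  have E: "entry M i j = R (xs ! i) (xs ! j)" if "i \<noteq> j" "i \<le> n" "j \<le> n" for i j
    using that n sym entry_pattern[of R i j xs] M by auto
  have va: "R ?v ?a" using assms(1) a len n E[of n a] by (auto simp: outer_ok_def Let_def)
  let ?D = "{y \<in> set (take n xs). y \<noteq> ?a \<and> R ?v y \<and> \<not> R ?a y}"
  have "filter (\<lambda>i. xs ! i \<noteq> ?a \<and> R ?v (xs ! i) \<and> \<not> R ?a (xs ! i)) [0..<n] =
      filter (\<lambda>i. i \<noteq> a \<and> entry M n i \<and> \<not> entry M a i) [0..<n]"
    using n a xs(1) by (intro filter_cong) (auto simp: E nth_eq_iff_index_eq)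
  then have D: "2 \<le> card ?D"
    using card_indices[of xs n "\<lambda>y. y \<noteq> ?a \<and> R ?v y \<and> \<not> R ?a y"] xs(1) n assms(1) len
    by (simp add: outer_ok_def Let_def)
  have fin: "finite {y \<in> U. P y}" for P using finite_U by simp
  have "insert ?a ?D \<subseteq> {y \<in> U. R ?v y}"
    using va v xs(2) by (auto dest: in_set_takeD)
  then have "card (insert ?a ?D \<union> {y \<in> U. R ?v y \<and> R ?a y}) \<le> card {y \<in> U. R ?v y}"
    by (intro card_mono fin) auto
  moreover have "insert ?a ?D \<inter> {y \<in> U. R ?v y \<and> R ?a y} = {}" using irrefl by auto
  ultimately have "card (insert ?a ?D) + card {y \<in> U. R ?v y \<and> R ?a y} \<le> card {y \<in> U. R ?v y}"
    by (subst (asm) card_Un_disjoint) (auto simp: finite_U)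
  \<comment> \<open>The 3 counts \<open>?a\<close> and two of its nonneighbours. Adding the centre
    leaves at most \<open>k - 1\<close> neighbours of \<open>?a\<close> accounted for, one fewer
    than it must have.\<close>
  then have "card {y \<in> U. R ?v y \<and> R ?a y} + 3 \<le> Suc k"
    using D degree_le[OF v(1)] by simp
  moreover have "k \<le> card {y \<in> U. R ?a y}" by (rule degree_ge[OF v(2)])
  ultimately have "card (insert ?v {y \<in> U. R ?v y \<and> R ?a y}) < card {y \<in> U. R ?a y}"
    by (simp add: card_insert_if fin irrefl)
  then have "\<not> {y \<in> U. R ?a y} \<subseteq> insert ?v {y \<in> U. R ?v y \<and> R ?a y}"
    using card_mono[of "insert ?v {y \<in> U. R ?v y \<and> R ?a y}" "{y \<in> U. R ?a y}"]
    by (auto simp del: insert_iff simp: finite_U)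
  then obtain y where y: "y \<in> U" "R ?a y" "\<not> R ?v y" "y \<noteq> ?v" by blast
  have "y \<notin> set xs"
  proof
    assume "y \<in> set xs"
    then obtain i where i: "i < length xs" "y = xs ! i" by (metis in_set_conv_nth)
    with y have "i \<noteq> n" "i \<noteq> a" using irrefl by auto
    with i n y have "i < n" by simp
    with assms(1) \<open>i \<noteq> a\<close> a len n y i show False
      by (auto simp: outer_ok_def Let_def list_all_iff E)
  qed
  show False
  proof (rule certifies_sound[OF assms(3,2)])
    show "R x y = R y x" for x y by (rule sym)
    show "distinct (y # xs)" "set (y # xs) \<subseteq> U" "pattern R xs = M" using xs y \<open>y \<notin> set xs\<close> M by auto
    show "length (outer_row a M) = length xs" by (simp add: outer_row_def len n)
    fix i c assume "i < length (outer_row a M)" "outer_row a M ! i = Some c"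
    then have "i = n \<and> \<not> c \<or> i = a \<and> c"
      using a by (auto simp: outer_row_def len n nth_append nth_list_update split: if_splits)
    then show "R y (xs ! i) = c" using y sym by auto
  qed
qed

end

section \<open>Five-wheels\<close>

definition bits :: "nat list list \<Rightarrow> bool list list" where
  "bits = map (map (\<lambda>b. b = 1))"

text \<open>Patterns with the exponents of a nonvanishing monomial, found by computer search. Entry 4 is a
  vertex joined to the complement of a path on six vertices.\<close>

definition reducible_patterns :: "(bool list list \<times> nat list) list" where
  "reducible_patterns = [
  (bits [[1, 1, 1, 0, 1], [1, 0, 1, 1], [1, 1, 1], [1, 1], [1], []],
   [2, 2, 2, 2, 2, 3]),
  (bits [[0, 1, 1, 0, 1, 0], [1, 0, 1, 0, 1], [1, 0, 1, 1], [1, 1, 1], [1, 1], [1], []],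
   [1, 1, 3, 2, 2, 3, 3]),
  (bits [[0, 1, 1, 1, 1, 1], [1, 1, 0, 0, 1], [1, 0, 1, 1], [1, 1, 1], [1, 1], [1], []],
   [1, 1, 3, 3, 2, 3, 4]),
  (bits [[0, 1, 1, 0, 1, 1], [1, 1, 1, 0, 1], [1, 1, 1, 1], [1, 1, 1], [1, 1], [1], []],
   [1, 2, 2, 3, 3, 3, 4]),
  (bits [[1, 0, 1, 0, 1, 1], [1, 0, 1, 0, 1], [0, 1, 1, 1], [1, 1, 1], [1, 1], [1], []],
   [2, 2, 1, 1, 3, 3, 4]),
  (bits [[0, 1, 0, 1, 1, 0], [1, 1, 0, 1, 1], [1, 0, 1, 1], [1, 0, 1], [1, 1], [1], []],
   [1, 1, 3, 2, 2, 3, 3]),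
  (bits [[0, 1, 1, 0, 1, 1, 0], [1, 0, 1, 0, 1, 1], [0, 1, 0, 1, 0], [1, 1, 0, 1], [0, 1, 1], [1, 1], [1], []],
   [1, 1, 2, 2, 3, 2, 4, 3]),
  (bits [[1, 0, 1, 0, 0, 1, 1, 1], [0, 1, 0, 0, 1, 0, 0], [1, 1, 1, 0, 0, 1], [0, 0, 1, 0, 1], [1, 0, 1, 1], [1, 1, 1], [1, 1], [1], []],
   [1, 1, 2, 2, 2, 2, 4, 3, 5]),
  (bits [[1, 0, 1, 0, 0, 1, 0, 0], [0, 1, 0, 0, 1, 0, 1], [0, 1, 1, 0, 1, 0], [0, 0, 1, 0, 1], [1, 0, 1, 1], [1, 1, 1], [1, 1], [1], []],
   [1, 1, 1, 2, 2, 2, 4, 3, 4]),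
  (bits [[1, 0, 0, 0, 0, 1, 1, 0], [0, 1, 0, 0, 0, 1, 1], [1, 1, 1, 0, 0, 0], [1, 0, 0, 0, 1], [1, 1, 0, 1], [1, 1, 1], [1, 1], [1], []],
   [1, 1, 1, 2, 3, 3, 2, 3, 4]),
  (bits [[1, 1, 1, 0, 0, 1, 1, 0], [0, 1, 0, 1, 0, 1, 0], [0, 1, 0, 1, 0, 0], [0, 0, 0, 1, 1], [1, 1, 0, 1], [1, 1, 1], [1, 1], [1], []],
   [1, 2, 1, 2, 2, 2, 4, 4, 3]),
  (bits [[1, 1, 1, 0, 0, 0, 0, 0], [1, 0, 1, 0, 0, 1, 0], [0, 0, 0, 1, 1, 0], [0, 1, 1, 0, 1], [1, 0, 1, 1], [1, 1, 1], [1, 1], [1], []],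
   [1, 1, 2, 2, 2, 2, 3, 4, 3]),
  (bits [[1, 0, 1, 1, 0, 0, 0, 0], [0, 1, 1, 0, 1, 1, 1], [0, 0, 1, 1, 0, 1], [1, 0, 0, 1, 0], [0, 1, 1, 1], [1, 1, 1], [1, 1], [1], []],
   [1, 1, 1, 2, 4, 2, 4, 4, 3]),
  (bits [[0, 1, 1, 0, 1, 1, 0, 0], [1, 1, 1, 0, 0, 0, 1], [1, 0, 0, 0, 0, 0], [1, 1, 0, 0, 1], [1, 0, 1, 1], [1, 1, 1], [1, 1], [1], []],
   [1, 1, 1, 4, 3, 4, 2, 2, 3]),
  (bits [[1, 0, 0, 1, 0, 1, 0, 0], [1, 1, 0, 0, 1, 1, 0], [1, 0, 0, 1, 1, 1], [0, 1, 0, 1, 0], [1, 1, 0, 1], [0, 1, 1], [1, 1], [1], []],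
   [1, 1, 2, 2, 2, 2, 4, 4, 3]),
  (bits [[0, 1, 1, 1, 0, 1, 0, 1, 0], [1, 0, 0, 0, 0, 1, 1, 1], [0, 1, 0, 0, 0, 1, 0], [1, 1, 1, 0, 0, 0], [0, 1, 0, 1, 0], [1, 1, 0, 1], [1, 1, 1], [1, 1], [1], []],
   [1, 1, 2, 2, 2, 2, 5, 2, 5, 3]),
  (bits [[1, 0, 0, 1, 0, 0, 1, 0, 0], [1, 0, 0, 1, 0, 1, 1, 0], [1, 0, 1, 0, 0, 1, 0], [1, 0, 1, 0, 0, 1], [0, 1, 1, 0, 1], [1, 1, 1, 1], [1, 1, 1], [1, 1], [1], []],
   [1, 3, 1, 2, 2, 2, 2, 5, 4, 4])]"

lemma reducible_patterns: "list_all (\<lambda>(M, ds). alon_tarsi_reducible M ds) reducible_patterns"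
  by code_simp

definition base_patterns :: "bool list list list" where
  "base_patterns = claw_pattern # map fst reducible_patterns"

text \<open>The wheel has rim \<open>c0, \<dots>, c4\<close> and centre \<open>v\<close>, listed in this order at the end of every pattern
  below. Vertices listed before them are adjacent to the following vertices:
  in \<open>wheel_hub\<close>, \<open>x\<close> to all; in \<open>wheel_four\<close>, \<open>x\<close> to all but \<open>c0\<close>; in \<open>wheel_twin\<close>,
  \<open>x\<close> to \<open>c4, c0, c1, v\<close>; \<open>twin_arc\<close> and \<open>twin_outer\<close> extend \<open>wheel_twin\<close> by \<open>y\<close> adjacent to
  \<open>c0, c1, c2\<close> and to \<open>x, c0, c1\<close>; and \<open>twin_outer_1\<close>, \<open>twin_outer_2\<close>, \<open>twin_outer_3\<close> extend
  \<open>twin_outer\<close> by a twin in the neighbourhood of \<open>v\<close> of \<open>c2\<close>, \<open>c3\<close> and \<open>c4\<close>, respectively.\<close>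

definition twin_arc :: "bool list list" where
  "twin_arc = bits [[0, 1, 1, 1, 0, 0, 0], [1, 1, 0, 0, 1, 1], [1, 0, 0, 1, 1], [1, 0, 0, 1], [1, 0, 1], [1, 1], [1], []]"

definition twin_outer_2 :: "bool list list" where
  "twin_outer_2 = bits [[0, 0, 0, 0, 1, 1, 1, 1], [1, 1, 1, 0, 0, 0, 0], [1, 1, 0, 0, 1, 1], [1, 0, 0, 1, 1], [1, 0, 0, 1], [1, 0, 1], [1, 1], [1], []]"

definition twin_outer_3 :: "bool list list" where
  "twin_outer_3 = bits [[0, 1, 1, 0, 0, 1, 1, 1], [1, 1, 1, 0, 0, 0, 0], [1, 1, 0, 0, 1, 1], [1, 0, 0, 1, 1], [1, 0, 0, 1], [1, 0, 1], [1, 1], [1], []]"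

definition twin_outer_1 :: "bool list list" where
  "twin_outer_1 = bits [[0, 0, 0, 1, 1, 1, 0, 1], [1, 1, 1, 0, 0, 0, 0], [1, 1, 0, 0, 1, 1], [1, 0, 0, 1, 1], [1, 0, 0, 1], [1, 0, 1], [1, 1], [1], []]"

definition twin_outer :: "bool list list" where
  "twin_outer = bits [[1, 1, 1, 0, 0, 0, 0], [1, 1, 0, 0, 1, 1], [1, 0, 0, 1, 1], [1, 0, 0, 1], [1, 0, 1], [1, 1], [1], []]"

definition wheel_twin :: "bool list list" where
  "wheel_twin = bits [[1, 1, 0, 0, 1, 1], [1, 0, 0, 1, 1], [1, 0, 0, 1], [1, 0, 1], [1, 1], [1], []]"

definition wheel_hub :: "bool list list" where
  "wheel_hub = bits [[1, 1, 1, 1, 1, 1], [1, 0, 0, 1, 1], [1, 0, 0, 1], [1, 0, 1], [1, 1], [1], []]"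

definition wheel_four :: "bool list list" where
  "wheel_four = bits [[0, 1, 1, 1, 1, 1], [1, 0, 0, 1, 1], [1, 0, 0, 1], [1, 0, 1], [1, 1], [1], []]"

definition wheel :: "bool list list" where
  "wheel = bits [[1, 0, 0, 1, 1], [1, 0, 0, 1], [1, 0, 1], [1, 1], [1], []]"

definition twin_arc_cert :: cert where
  "twin_arc_cert =
     Branch 0 (Branch 5 (Leaf [0, 1, 2, 6]) (Branch 4 (Branch 3 (Branch 2 (Leaf [8, 5, 1, 2, 0,
     3, 4]) (Branch 6 (Leaf [7, 0, 3, 6]) (Leaf [5, 0, 6, 1, 7, 2, 8, 4, 3]))) (Leaf [5, 0, 4,
     6])) (Branch 2 (Branch 3 (Branch 6 (Leaf [0, 4, 2, 7, 8, 3]) (Leaf [5, 7, 6, 8, 2, 4, 1,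
     0, 3])) (Branch 6 (Leaf [6, 7, 2, 0, 5, 1, 8, 3, 4]) (Leaf [2, 0, 4, 7]))) (Leaf [1, 0, 3,
     5])))) (Branch 2 (Leaf [3, 0, 1, 8]) (Branch 3 (Leaf [4, 0, 1, 8]) (Branch 4 (Leaf [5, 0,
     1, 8]) (Branch 6 (Branch 5 (Leaf [0, 6, 1, 5, 4, 3, 2, 7, 8]) (Leaf [7, 0, 3, 6])) (Leaf
     [2, 0, 4, 7])))))"

text \<open>Index 1 is \<open>x\<close>. The rim vertices \<open>c0\<close>, \<open>c1\<close>,
  \<open>c2\<close> would fail \<open>outer_ok\<close>, being adjacent to \<open>y\<close> outside
  the neighbourhood of \<open>v\<close>.\<close>

lemma twin_arc_cert: "outer_ok 1 twin_arc" "certifies base_patterns twin_arc (outer_row 1 twin_arc) twin_arc_cert"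
  by code_simp+

definition twin_outer_2_cert :: cert where
  "twin_outer_2_cert =
     Branch 2 (Branch 1 (Branch 5 (Leaf [0, 2, 6, 8]) (Branch 0 (Branch 3 (Leaf [2, 1, 0, 3, 9,
     4, 8]) (Branch 4 (Leaf [5, 0, 4, 6]) (Leaf [0, 4, 3, 8, 1, 6, 5, 9]))) (Branch 3 (Branch 6
     (Leaf [2, 7, 0, 3, 9, 4, 8]) (Leaf [6, 1, 2, 7, 0, 3, 9, 4, 8])) (Leaf [8, 0, 1, 4]))))
     (Leaf [3, 0, 2, 9])) (Branch 0 (Branch 6 (Branch 5 (Leaf [0, 6, 1, 8, 9, 7]) (Branch 3
     (Leaf [6, 4, 9, 1, 0, 7, 8]) (Branch 4 (Leaf [5, 0, 3, 6]) (Branch 1 (Leaf [2, 5, 3, 0, 6,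
     1, 8, 9, 7]) (Leaf [0, 1, 2, 7, 5, 3, 8, 4, 9]))))) (Leaf [8, 0, 3, 7])) (Leaf [8, 0, 1,
     3]))"

text \<open>Index 7 is \<open>c4\<close>. Here \<open>x\<close>, \<open>c0\<close> and
  \<open>c1\<close> are ruled out, as \<open>y\<close> is adjacent to them but not to
  \<open>v\<close>.\<close>

lemma twin_outer_2_cert: "outer_ok 7 twin_outer_2" "certifies (base_patterns @ [twin_arc]) twin_outer_2 (outer_row 7 twin_outer_2) twin_outer_2_cert"
  by code_simp+

definition twin_outer_3_cert :: cert where
  "twin_outer_3_cert =
     Branch 6 (Branch 0 (Branch 2 (Leaf [0, 3, 1, 7, 9, 8]) (Branch 3 (Leaf [0, 4, 1, 7, 9, 8])
     (Branch 5 (Leaf [3, 6, 9, 1, 0, 8, 7]) (Branch 4 (Leaf [5, 0, 3, 6]) (Branch 1 (Leaf [6,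
     7, 0, 2, 5, 1, 3, 9, 8, 4]) (Leaf [0, 1, 2, 7, 8, 5, 3, 9, 4])))))) (Branch 5 (Branch 2
     (Leaf [6, 1, 9, 3, 0, 7, 8]) (Branch 4 (Leaf [5, 1, 3, 0, 8, 6, 9, 7]) (Leaf [0, 1, 8, 7,
     6, 5, 3, 9]))) (Leaf [7, 0, 1, 6]))) (Branch 2 (Branch 3 (Branch 0 (Leaf [3, 7, 9, 1, 0,
     4, 8]) (Branch 4 (Leaf [0, 5, 3, 8, 9, 4]) (Leaf [3, 0, 1, 5]))) (Leaf [8, 0, 4, 7]))
     (Leaf [8, 0, 3, 7]))"

lemma twin_outer_3_cert: "outer_ok 7 twin_outer_3" "certifies (base_patterns @ [twin_arc]) twin_outer_3 (outer_row 7 twin_outer_3) twin_outer_3_cert"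
  by code_simp+

definition twin_outer_1_cert :: cert where
  "twin_outer_1_cert =
     Branch 4 (Branch 1 (Branch 7 (Leaf [0, 2, 6, 8]) (Branch 0 (Branch 6 (Leaf [0, 5, 1, 7, 9,
     6]) (Branch 2 (Leaf [7, 3, 9, 1, 0, 6, 5]) (Branch 3 (Leaf [0, 3, 4, 5, 1, 7, 8, 9]) (Leaf
     [1, 8, 7, 0, 6, 2, 5, 3, 9, 4])))) (Branch 2 (Branch 3 (Leaf [8, 6, 9, 3, 0, 4, 5]) (Leaf
     [5, 0, 1, 4])) (Leaf [5, 0, 1, 3])))) (Leaf [5, 0, 2, 9])) (Branch 6 (Branch 0 (Branch 7
     (Leaf [5, 8, 9, 1, 0, 6, 7]) (Branch 2 (Leaf [3, 0, 5, 8]) (Branch 3 (Leaf [4, 0, 5, 8])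
     (Leaf [3, 0, 1, 6, 7, 8, 4, 5, 9])))) (Branch 7 (Branch 2 (Leaf [3, 1, 5, 0, 6, 8, 9, 7])
     (Leaf [0, 1, 6, 7, 8, 3, 5, 9])) (Leaf [7, 0, 1, 8]))) (Leaf [6, 0, 5, 7]))"

lemma twin_outer_1_cert: "outer_ok 5 twin_outer_1" "certifies (base_patterns @ [twin_outer_2, twin_arc]) twin_outer_1 (outer_row 5 twin_outer_1) twin_outer_1_cert"
  by code_simp+

definition twin_outer_cert :: cert where
  "twin_outer_cert =
     Branch 1 (Branch 0 (Branch 2 (Branch 3 (Branch 6 (Leaf [7, 1, 0, 2, 4, 8, 3]) (Leaf [0, 7,
     8, 2, 1, 4, 3])) (Leaf [0, 1, 2, 8, 4, 3])) (Branch 3 (Leaf [0, 1, 2, 8, 3, 4]) (Branch 4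
     (Leaf [5, 3, 4, 1, 0, 8, 2]) (Leaf [8, 0, 3, 5])))) (Branch 6 (Branch 3 (Branch 2 (Leaf
     [0, 1, 4, 2, 7, 8, 3]) (Leaf [0, 4, 2, 7, 3, 8])) (Branch 5 (Branch 2 (Branch 4 (Leaf [1,
     5, 4, 2, 0, 3, 8]) (Leaf [0, 1, 2, 3, 4, 5, 6, 7, 8])) (Branch 4 (Leaf [3, 1, 5, 4, 6, 0,
     2, 7, 8]) (Leaf [8, 0, 3, 5]))) (Leaf [8, 0, 4, 6]))) (Leaf [2, 0, 1, 7]))) (Branch 4
     (Branch 5 (Branch 6 (Branch 0 (Leaf [0, 1, 5, 7]) (Branch 2 (Branch 3 (Leaf [0, 4, 3, 7,
     2, 8]) (Leaf [2, 1, 5, 4, 6, 0, 3, 7, 8])) (Branch 3 (Leaf [1, 0, 4, 2, 7, 3, 8]) (Leaf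
     [0, 1, 2, 3, 4, 5, 6, 7, 8])))) (Branch 3 (Branch 0 (Leaf [1, 5, 0, 4, 2, 7, 6, 8])
     (Branch 2 (Leaf [3, 0, 1, 7]) (Leaf [0, 1, 2, 3, 4, 5, 6, 7, 8]))) (Leaf [8, 0, 4, 7])))
     (Leaf [8, 0, 2, 6])) (Leaf [8, 0, 2, 5]))"

lemma twin_outer_cert: "inner_ok twin_outer" "certifies (base_patterns @ [twin_arc, twin_outer_1, twin_outer_2, twin_outer_3]) twin_outer (inner_row twin_outer) twin_outer_cert"
  by code_simp+

definition wheel_twin_cert :: cert where
  "wheel_twin_cert =
     Branch 2 (Branch 0 (Branch 5 (Leaf [0, 3, 1, 6, 7, 2]) (Branch 3 (Leaf [6, 4, 7, 1, 0, 2,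
     3]) (Branch 4 (Leaf [5, 0, 4, 6]) (Leaf [0, 1, 2, 3, 4, 5, 6, 7])))) (Branch 3 (Branch 5
     (Leaf [4, 1, 7, 6, 0, 3, 2]) (Branch 4 (Leaf [5, 1, 6, 0, 2, 4, 7, 3]) (Leaf [0, 1, 2, 3,
     4, 5, 6, 7]))) (Leaf [3, 0, 1, 4]))) (Branch 5 (Branch 0 (Branch 4 (Leaf [3, 5, 7, 1, 0,
     2, 6]) (Branch 3 (Leaf [4, 0, 3, 5]) (Leaf [0, 1, 2, 6, 5, 4, 3, 7]))) (Branch 4 (Branch 3
     (Leaf [4, 1, 3, 0, 2, 5, 7, 6]) (Leaf [0, 1, 2, 6, 5, 4, 3, 7])) (Leaf [6, 0, 1, 5])))
     (Leaf [2, 0, 3, 6]))"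

text \<open>A new outer neighbour of \<open>c0\<close> must see \<open>c1\<close> or
  \<open>c4\<close>, by claw-freeness at \<open>c0\<close>. Up to reflection,
  \<open>twin_outer\<close> and \<open>twin_arc\<close> are what remains besides the base
  patterns.\<close>

lemma wheel_twin_cert: "outer_ok 1 wheel_twin" "certifies (base_patterns @ [twin_outer, twin_arc]) wheel_twin (outer_row 1 wheel_twin) wheel_twin_cert"
  by code_simp+

definition wheel_hub_cert :: cert where
  "wheel_hub_cert =
     Branch 1 (Branch 2 (Branch 3 (Branch 0 (Branch 4 (Leaf [5, 2, 0, 1, 3, 4, 7]) (Leaf [0, 5,
     4, 1, 2, 3, 7])) (Leaf [0, 2, 3, 4, 1, 7])) (Branch 5 (Branch 0 (Leaf [0, 4, 3, 1, 6, 2,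
     7]) (Leaf [0, 3, 2, 6, 1, 7])) (Leaf [7, 0, 4, 6]))) (Branch 4 (Branch 5 (Branch 0 (Leaf
     [0, 3, 2, 1, 5, 6, 7]) (Leaf [0, 2, 6, 5, 1, 7])) (Leaf [2, 0, 3, 6])) (Leaf [7, 0, 3,
     5]))) (Branch 3 (Branch 4 (Branch 2 (Branch 0 (Leaf [0, 2, 3, 1, 5, 4, 7]) (Leaf [0, 3, 4,
     5, 1, 7])) (Branch 5 (Leaf [0, 5, 4, 3, 2, 6, 7]) (Leaf [7, 0, 3, 6]))) (Leaf [7, 0, 2,
     5])) (Leaf [7, 0, 2, 4]))"

lemma wheel_hub_cert: "inner_ok wheel_hub" "certifies (base_patterns @ [wheel_twin]) wheel_hub (inner_row wheel_hub) wheel_hub_cert"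
  by code_simp+

definition wheel_four_cert :: cert where
  "wheel_four_cert =
     Branch 2 (Branch 3 (Branch 4 (Branch 0 (Branch 5 (Leaf [6, 3, 0, 1, 4, 5, 7]) (Leaf [0, 6,
     5, 1, 3, 4, 7])) (Leaf [0, 3, 4, 5, 1, 7])) (Branch 1 (Branch 5 (Branch 0 (Leaf [1, 3, 0,
     6, 2, 7]) (Leaf [1, 6, 2, 4, 0, 3, 7])) (Leaf [0, 3, 2, 6, 5, 4, 7])) (Leaf [7, 0, 2,
     5]))) (Branch 1 (Branch 5 (Branch 0 (Leaf [1, 3, 0, 6, 2, 7]) (Branch 4 (Leaf [1, 3, 2, 5,
     0, 6, 7]) (Leaf [0, 2, 3, 4, 5, 6, 7]))) (Leaf [7, 0, 4, 6])) (Leaf [3, 0, 2, 4])))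
     (Branch 4 (Branch 5 (Branch 3 (Branch 0 (Leaf [0, 3, 4, 1, 6, 5, 7]) (Leaf [0, 4, 5, 6, 1,
     7])) (Branch 1 (Leaf [0, 6, 2, 3, 4, 5, 7]) (Leaf [7, 0, 2, 4]))) (Leaf [7, 0, 3, 6]))
     (Leaf [7, 0, 3, 5]))"

lemma wheel_four_cert: "inner_ok wheel_four" "certifies (base_patterns @ [wheel_twin]) wheel_four (inner_row wheel_four) wheel_four_cert"
  by code_simp+

definition wheel_cert :: cert where
  "wheel_cert =
     Branch 0 (Branch 1 (Branch 2 (Branch 3 (Branch 4 (Leaf [0, 1, 2, 3, 4, 5, 6]) (Leaf [0, 5,
     1, 2, 3, 4, 6])) (Branch 4 (Leaf [0, 4, 3, 2, 1, 5, 6]) (Leaf [0, 2, 1, 5, 4, 3, 6])))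
     (Branch 4 (Branch 3 (Leaf [0, 3, 2, 1, 5, 4, 6]) (Leaf [0, 1, 2, 3, 4, 5, 6])) (Leaf [6,
     0, 3, 5]))) (Branch 3 (Branch 4 (Branch 2 (Leaf [0, 2, 1, 5, 4, 3, 6]) (Leaf [0, 5, 1, 2,
     3, 4, 6])) (Leaf [1, 0, 2, 5])) (Leaf [6, 0, 2, 4]))) (Branch 2 (Branch 3 (Branch 1
     (Branch 4 (Leaf [0, 1, 2, 3, 4, 5, 6]) (Leaf [0, 3, 2, 1, 5, 4, 6])) (Branch 4 (Leaf [0,
     4, 3, 2, 1, 5, 6]) (Leaf [6, 0, 2, 5]))) (Leaf [6, 0, 1, 4])) (Leaf [6, 0, 1, 3]))"

text \<open>By claw-freeness at \<open>v\<close>, the rim vertices missed by a further neighbour of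
  \<open>v\<close> are pairwise adjacent: none (\<open>wheel_hub\<close>), one
  (\<open>wheel_four\<close>) or two consecutive ones (\<open>wheel_twin\<close>).\<close>

lemma wheel_cert: "inner_ok wheel" "certifies (base_patterns @ [wheel_twin, wheel_hub, wheel_four]) wheel (inner_row wheel) wheel_cert"
  by code_simp+

section \<open>Excluding the five-wheel and its extensions\<close>

context claw_free_list_critical
begin

lemma avoids_base: "list_all (avoids U R) base_patterns"
  using reducible_patterns avoids_claw avoids_if_alon_tarsi_reducible
  by (auto simp: base_patterns_def list_all_iff)

lemma avoids_twin_arc: "avoids U R twin_arc"
  by (rule avoids_outer[OF twin_arc_cert(1) _ twin_arc_cert(2)])
    (use avoids_base in simp)

lemma avoids_twin_outer_2: "avoids U R twin_outer_2"
  by (rule avoids_outer[OF twin_outer_2_cert(1) _ twin_outer_2_cert(2)])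
    (use avoids_base avoids_twin_arc in simp)

lemma avoids_twin_outer_3: "avoids U R twin_outer_3"
  by (rule avoids_outer[OF twin_outer_3_cert(1) _ twin_outer_3_cert(2)])
    (use avoids_base avoids_twin_arc in simp)

lemma avoids_twin_outer_1: "avoids U R twin_outer_1"
  by (rule avoids_outer[OF twin_outer_1_cert(1) _ twin_outer_1_cert(2)])
    (use avoids_base avoids_twin_outer_2 avoids_twin_arc in simp)

lemma avoids_twin_outer: "avoids U R twin_outer"
  by (rule avoids_inner[OF twin_outer_cert(1) _ twin_outer_cert(2)])
    (use avoids_base avoids_twin_arc avoids_twin_outer_1 avoids_twin_outer_2 avoids_twin_outer_3 in simp)

lemma avoids_wheel_twin: "avoids U R wheel_twin"
  by (rule avoids_outer[OF wheel_twin_cert(1) _ wheel_twin_cert(2)])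
    (use avoids_base avoids_twin_outer avoids_twin_arc in simp)

lemma avoids_wheel_hub: "avoids U R wheel_hub"
  by (rule avoids_inner[OF wheel_hub_cert(1) _ wheel_hub_cert(2)])
    (use avoids_base avoids_wheel_twin in simp)

lemma avoids_wheel_four: "avoids U R wheel_four"
  by (rule avoids_inner[OF wheel_four_cert(1) _ wheel_four_cert(2)])
    (use avoids_base avoids_wheel_twin in simp)

lemma avoids_wheel: "avoids U R wheel"
  by (rule avoids_inner[OF wheel_cert(1) _ wheel_cert(2)])
    (use avoids_base avoids_wheel_twin avoids_wheel_hub avoids_wheel_four in simp)

end

section \<open>Neighbourhoods are covered by two cliques\<close>

text \<open>Divide each component by the parity of walks to a chosen root. Adjacent vertices reach
  the same vertices, so \<open>SOME\<close> gives them the same root, and equal parities would close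
  up to an odd walk.\<close>

lemma bipartition_if_no_odd_closed_walk:
  assumes "sym T" and no_odd: "\<And>x n. odd n \<Longrightarrow> (x, x) \<notin> T ^^ n"
  shows "\<exists>A. \<forall>(x, y)\<in>T. x \<in> A \<longleftrightarrow> y \<notin> A"
proof -
  define root where "root x = (SOME z. (x, z) \<in> T\<^sup>*)" for x
  have rev: "(y, x) \<in> T ^^ n" if "(x, y) \<in> T ^^ n" for x y n
    using that
  proof (induction n arbitrary: y)
    case (Suc n)
    from Suc.prems obtain z where z: "(x, z) \<in> T ^^ n" "(z, y) \<in> T" by (rule relpow_Suc_E)
    from relpow_Suc_I2[OF symD[OF assms(1) z(2)] Suc.IH[OF z(1)]] show ?case .
  qed simp
  define A where "A = {x. \<exists>n. even n \<and> (x, root x) \<in> T ^^ n}"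
  have "x \<in> A \<longleftrightarrow> y \<notin> A" if xy: "(x, y) \<in> T" for x y
  proof -
    have yx: "(y, x) \<in> T" using xy assms(1) by (meson symD)
    have "(x, z) \<in> T\<^sup>* \<longleftrightarrow> (y, z) \<in> T\<^sup>*" for z
      using converse_rtrancl_into_rtrancl[OF xy, of z] converse_rtrancl_into_rtrancl[OF yx, of z] by blast
    then have root: "root x = root y" by (simp add: root_def)
    have "(x, root x) \<in> T\<^sup>*" unfolding root_def by (rule someI[of _ x]) simp
    from rtrancl_imp_relpow[OF this] obtain n where n: "(x, root x) \<in> T ^^ n" ..
    have Suc: "(y, root y) \<in> T ^^ Suc m" if "(x, root x) \<in> T ^^ m" for m
      using relpow_Suc_I2[OF yx that] root by simp
    have "x \<notin> A \<or> y \<notin> A"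
    proof (rule ccontr)
      assume "\<not> ?thesis"
      then have "x \<in> A" "y \<in> A" by simp_all
      then obtain m1 m2 where m: "even m1" "even m2" "(x, root x) \<in> T ^^ m1" "(y, root y) \<in> T ^^ m2"
        unfolding A_def by blast
      from Suc[OF m(3)] rev[OF m(4)] have "(y, y) \<in> T ^^ Suc m1 O T ^^ m2" by (rule relcompI)
      then have "(y, y) \<in> T ^^ (Suc m1 + m2)" by (simp only: relpow_add)
      with no_odd[of "Suc m1 + m2" y] m(1,2) show False by (simp del: relpow.simps)
    qed
    moreover have "x \<in> A \<or> y \<in> A"
    proof (cases "even n")
      case False
      with Suc[OF n] have "even (Suc n) \<and> (y, root y) \<in> T ^^ Suc n" by simp
      then show ?thesis unfolding A_def by blast
    qed (use n in \<open>auto simp: A_def\<close>)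
    ultimately show ?thesis by blast
  qed
  then show ?thesis by (intro exI[of _ A]) auto
qed

text \<open>A shortest odd closed walk is an induced cycle.\<close>

lemma induced_odd_cycle:
  assumes "sym T" "odd m" "(x, x) \<in> T ^^ m"
  obtains n f where "odd n" "f n = f 0" "\<And>i. i < n \<Longrightarrow> (f i, f (Suc i)) \<in> T"
    "\<And>i j. i < j \<Longrightarrow> j < n \<Longrightarrow> f i \<noteq> f j"
    "\<And>i j. i < j \<Longrightarrow> j < n \<Longrightarrow> (f i, f j) \<in> T \<longleftrightarrow> j = Suc i \<or> i = 0 \<and> Suc j = n"
proof -
  let ?P = "\<lambda>n. odd n \<and> (\<exists>x. (x, x) \<in> T ^^ n)"
  define n where "n = (LEAST n. ?P n)"
  have "?P m" using assms by blast
  then have "?P n" unfolding n_def by (rule LeastI)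
  then obtain z where n: "odd n" "(z, z) \<in> T ^^ n" by blast
  have min: "(x, x) \<notin> T ^^ l" if "l < n" "odd l" for x l
    using not_less_Least[of l ?P] that unfolding n_def by blast
  from n(2) obtain f where f: "f 0 = z" "f n = z" "\<And>i. i < n \<Longrightarrow> (f i, f (Suc i)) \<in> T"
    by (auto simp: relpow_fun_conv)
  have seg: "(f i, f j) \<in> T ^^ (j - i)" if "i \<le> j" "j \<le> n" for i j
    unfolding relpow_fun_conv using that f(3) by (intro exI[of _ "\<lambda>l. f (i + l)"]) auto
  have wrap: "(f j, f i) \<in> T ^^ (n - j + i)" if "i < j" "j < n" for i j
  proof -
    have "(f j, f n) \<in> T ^^ (n - j)" "(f n, f i) \<in> T ^^ i"
      using seg[of j n] seg[of 0 i] that f(1,2) by simp_all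
    then show ?thesis unfolding relpow_add by (rule relcompI)
  qed
  \<comment> \<open>A repeated vertex splits the walk into closed walks of lengths
    \<open>j - i\<close> and \<open>n - j + i\<close>; one of them is odd and shorter.\<close>
  have dist: "f i \<noteq> f j" if ij: "i < j" "j < n" for i j
  proof
    assume eq: "f i = f j"
    show False
    proof (cases "odd (j - i)")
      case True
      moreover have "j - i < n" using ij by arith
      moreover have "(f i, f i) \<in> T ^^ (j - i)" using seg[of i j] ij eq by simp
      ultimately show False using min by blast
    next
      case False
      then have "odd (n - j + i)" "n - j + i < n" using ij n(1) by auto
      moreover have "(f i, f i) \<in> T ^^ (n - j + i)" using wrap[OF ij] eq by simp
      ultimately show False using min by blast
    qed
  qed
  \<comment> \<open>A chord closes both arcs, giving closed walks whose lengths add up to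
    \<open>n + 2\<close>; again one is odd and shorter.\<close>
  have chord: "j = Suc i \<or> i = 0 \<and> Suc j = n" if ij: "i < j" "j < n" and T: "(f i, f j) \<in> T" for i j
  proof (rule ccontr)
    assume no: "\<not> ?thesis"
    have T': "(f j, f i) \<in> T" using T assms(1) by (meson symD)
    show False
    proof (cases "odd (j - i)")
      case True
      then have "odd (Suc (n - j + i))" "Suc (n - j + i) < n" using ij n(1) no by auto
      moreover have "(f j, f j) \<in> T ^^ Suc (n - j + i)" using wrap[OF ij] T by (rule relpow_Suc_I)
      ultimately show False using min by blast
    next
      case False
      then have "odd (Suc (j - i))" "Suc (j - i) < n" using ij no by auto
      moreover have "(f i, f i) \<in> T ^^ Suc (j - i)" using seg[of i j] ij T' by (intro relpow_Suc_I) auto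
      ultimately show False using min by blast
    qed
  qed
  have last: "(f 0, f j) \<in> T" if "Suc j = n" for j
    using f(3)[of j] f(1,2) that assms(1) by (auto dest: symD)
  show ?thesis
  proof (rule that[of n f])
    show "(f i, f j) \<in> T \<longleftrightarrow> j = Suc i \<or> i = 0 \<and> Suc j = n" if "i < j" "j < n" for i j
      using chord[OF that] f(3)[of i] last[of j] that by auto
  qed (use n f dist in auto)
qed

context claw_free_list_critical
begin

text \<open>A bipartition of the complement of the neighbourhood gives two cliques. Otherwise a
  shortest odd cycle there yields a claw (length 3), a five-wheel (length 5) or, on six consecutive
  vertices, the complement of a path.\<close>

theorem neighbourhood_two_cliques:
  assumes v: "v \<in> U"
  shows "\<exists>A. \<forall>x\<in>{y \<in> U. R v y}. \<forall>y\<in>{y \<in> U. R v y}. x \<noteq> y \<longrightarrow> (x \<in> A \<longleftrightarrow> y \<in> A) \<longrightarrow> R x y"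
proof -
  define N where "N = {y \<in> U. R v y}"
  define T where "T = {(x, y). x \<in> N \<and> y \<in> N \<and> x \<noteq> y \<and> \<not> R x y}"
  have "sym T" using sym by (auto simp: T_def sym_def)
  have "(x, x) \<notin> T ^^ m" if "odd m" for x m
  proof
    assume "(x, x) \<in> T ^^ m"
    from induced_odd_cycle[OF \<open>sym T\<close> \<open>odd m\<close> this] obtain n f where
      n: "odd n" and f: "f n = f 0" "\<And>i. i < n \<Longrightarrow> (f i, f (Suc i)) \<in> T"
      and dist: "\<And>i j. i < j \<Longrightarrow> j < n \<Longrightarrow> f i \<noteq> f j"
      and iff: "\<And>i j. i < j \<Longrightarrow> j < n \<Longrightarrow> (f i, f j) \<in> T \<longleftrightarrow> j = Suc i \<or> i = 0 \<and> Suc j = n"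
      by blast
    have fN: "f i \<in> N" if "i < n" for i using f(2)[OF that] by (auto simp: T_def)
    then have fU: "f i \<in> U" "R v (f i)" "R (f i) v" "f i \<noteq> v" "v \<noteq> f i" if "i < n" for i
      using that sym irrefl by (auto simp: N_def)
    have adj: "R (f i) (f j) \<longleftrightarrow> \<not> (j = Suc i \<or> i = 0 \<and> Suc j = n)"
      "R (f j) (f i) \<longleftrightarrow> \<not> (j = Suc i \<or> i = 0 \<and> Suc j = n)"
      if "i < j" "j < n" for i j
      using iff[OF that] dist[OF that] fN[of i] fN[of j] that sym by (auto simp: T_def)
    have dist': "f j \<noteq> f i" if "i < j" "j < n" for i j using dist[OF that] by simp
    have "n \<noteq> 1" using f by (auto simp: T_def)
    moreover have "n \<noteq> 3"
    proof
      assume "n = 3"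
      with claw_free[of v "f 0" "f 1" "f 2"] v show False
        by (simp add: fU adj dist)
    qed
    ultimately have "n = 5 \<or> 7 \<le> n" using n by presburger
    then show False
    proof
      assume n: "n = 5"
      \<comment> \<open>The complement of a 5-cycle is the 5-cycle through every second
        vertex.\<close>
      let ?xs = "[f 0, f 2, f 4, f 1, f 3, v]"
      have "distinct ?xs" "set ?xs \<subseteq> U" using n v by (simp_all add: fU dist dist')
      moreover have "avoids U R wheel"
        by (rule avoids_wheel)
      ultimately have "pattern R ?xs \<noteq> wheel" unfolding avoids_def by blast
      then show False using n by (simp add: wheel_def bits_def fU adj)
    next
      assume n: "7 \<le> n"
      \<comment> \<open>As \<open>7 \<le> n\<close>, the vertices \<open>f 0\<close> to
        \<open>f 5\<close> induce a path in \<open>T\<close>; they are listed in the order of the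
        stored pattern.\<close>
      let ?xs = "[f 1, f 4, f 2, f 3, f 0, f 5, v]"
      have "distinct ?xs" "set ?xs \<subseteq> U" using n v by (simp_all add: fU dist dist')
      moreover have "avoids U R (fst (reducible_patterns ! 4))"
        using avoids_base by (simp add: base_patterns_def reducible_patterns_def)
      ultimately have "pattern R ?xs \<noteq> (fst (reducible_patterns ! 4))" unfolding avoids_def by blast
      then show False using n by (simp add: reducible_patterns_def bits_def fU adj)
    qed
  qed
  from bipartition_if_no_odd_closed_walk[OF \<open>sym T\<close> this] obtain A
    where "\<forall>(x, y)\<in>T. x \<in> A \<longleftrightarrow> y \<notin> A" by blast
  then show ?thesis by (intro exI[of _ A]) (auto simp: T_def N_def)
qed

end

section \<open>Reduction to quasi-line graphs\<close>

lemma sym_parcs: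
  assumes "pair_graph G"
  shows "(x, y) \<in> parcs G \<longleftrightarrow> (y, x) \<in> parcs G"
proof -
  interpret pair_graph G by (rule assms)
  show ?thesis using sym_arcs by (auto simp: symmetric_def dest: symD)
qed

lemma out_degree_eq_card_nbhd: "out_degree (with_proj G) v = card (nbhd G v)"
proof -
  have "out_arcs (with_proj G) v = Pair v ` nbhd G v"
    by (auto simp: out_arcs_def nbhd_def)
  then show ?thesis by (simp add: out_degree_def card_image inj_on_def)
qed

lemma card_nbhd_le_max_degree:
  assumes "pair_graph G" "v \<in> pverts G"
  shows "card (nbhd G v) \<le> max_degree G"
proof -
  interpret pair_graph G by (rule assms)
  show ?thesis
    unfolding max_degree_def out_degree_eq_card_nbhd[symmetric]
    using assms(2) pair_finite_verts by (intro Max_ge) auto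
qed

text \<open>Otherwise the four vertices would induce the star \<open>?H\<close>.\<close>

lemma claw_freeD:
  assumes "pair_graph G" "claw_free G" "distinct [a, b, c]"
    and x: "(x, a) \<in> parcs G" "(x, b) \<in> parcs G" "(x, c) \<in> parcs G"
  shows "(a, b) \<in> parcs G \<or> (a, c) \<in> parcs G \<or> (b, c) \<in> parcs G"
proof (rule ccontr)
  assume no: "\<not> ?thesis"
  interpret pair_graph G by (rule assms)
  note sym = sym_parcs[OF assms(1)]
  let ?H = "\<lparr>pverts = {x, a, b, c}, parcs = {x} \<times> {a, b, c} \<union> {a, b, c} \<times> {x}\<rparr>"
  have irr: "(z, z) \<notin> parcs G" for z using pair_no_loops[of "(z, z)"] by auto
  have ne: "x \<noteq> a" "x \<noteq> b" "x \<noteq> c" using x irr by auto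
  have "{x, a, b, c} \<subseteq> pverts G" using x in_arcsD1 in_arcsD2 by blast
  moreover have rev: "(a, x) \<in> parcs G" "(b, x) \<in> parcs G" "(c, x) \<in> parcs G"
    "(b, a) \<notin> parcs G" "(c, a) \<notin> parcs G" "(c, b) \<notin> parcs G"
    using x no sym by blast+
  have "parcs ?H = {e \<in> parcs G. fst e \<in> {x, a, b, c} \<and> snd e \<in> {x, a, b, c}}"
  proof (intro set_eqI)
    fix e show "e \<in> parcs ?H \<longleftrightarrow> e \<in> {e \<in> parcs G. fst e \<in> {x, a, b, c} \<and> snd e \<in> {x, a, b, c}}"
      using x no irr rev by (cases e) auto
  qed
  moreover have "wf_digraph (with_proj ?H)"
    unfolding wf_digraph_wp_iff by (rule pair_wf_digraph.intro) auto
  ultimately have "induced_subgraph ?H G"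
    using wf_digraph_axioms
    by (simp add: induced_subgraph_def subgraph_def compatible_def)
  moreover have "K\<^bsub>1,3\<^esub> ?H"
    unfolding complete_bipartite_digraph_pair_def
    by (rule conjI, simp, rule exI[of _ "{x}"], rule exI[of _ "{a, b, c}"]) (use ne assms(3) in \<open>simp add: insert_commute\<close>)
  ultimately show False using assms(2) unfolding claw_free_def by blast
qed

context claw_free_list_critical
begin

text \<open>The critical graph itself may have maximum degree \<open>k\<close>. The disjoint union with a vertex joined to two
  cliques on 4 and \<open>k - 3\<close> vertices has maximum degree \<open>k + 1\<close> and no new complete subgraph on
  \<open>k + 1\<close> vertices, so no list version of Brooks' theorem is needed.\<close>

lemma ex_nat_quasi_line_graph:
  "\<exists>H :: nat pair_pre_digraph. pair_graph H \<and> quasi_line H \<and> max_degree H = Suc k \<and>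
     Suc k \<le> list_chromatic_number H \<and>
     (contains_complete (Suc k) H \<longrightarrow>
       (\<exists>C\<subseteq>U. card C = Suc k \<and> (\<forall>x\<in>C. \<forall>y\<in>C. x \<noteq> y \<longrightarrow> R x y)))"
proof -
  \<comment> \<open>\<open>U\<close> is renamed to the numbers below \<open>n\<close>, since the
    result is to be a graph on naturals; the added component occupies \<open>n\<close> to
    \<open>n + Suc k\<close>.\<close>
  define n where "n = card U"
  obtain h where "bij_betw h U {0..<n}"
    using ex_bij_betw_finite_nat[OF finite_U] by (auto simp: n_def)
  then have inj: "inj_on h U" and im: "h ` U = {0..<n}" by (auto simp: bij_betw_def)
  have hn: "h x < n" if "x \<in> U" for x using im that by auto
  have h_ne: "h x \<noteq> n + i" "n + i \<noteq> h x" if "x \<in> U" for x i using hn[OF that] by auto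
  have h_eq: "h x = h y \<longleftrightarrow> x = y" if "x \<in> U" "y \<in> U" for x y
    using inj that by (auto simp: inj_on_eq_iff)
  \<comment> \<open>The cliques are \<open>{0..4}\<close> and
    \<open>{0} \<union> {5..Suc k}\<close>. Their common vertex 0 has degree \<open>Suc k\<close>,
    while their sizes 5 and \<open>k - 2\<close> are below \<open>Suc k\<close>.\<close>
  define P where "P i j \<longleftrightarrow> i \<noteq> j \<and> i \<le> Suc k \<and> j \<le> Suc k \<and>
    (i \<le> 4 \<and> j \<le> 4 \<or> i \<notin> {1..4} \<and> j \<notin> {1..4})" for i j :: nat
  have P_sym: "P j i" if "P i j" for i j using that by (auto simp: P_def)
  define H :: "nat pair_pre_digraph" where
    "H = \<lparr>pverts = h ` U \<union> (+) n ` {..Suc k},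
          parcs = {(h x, h y) |x y. x \<in> U \<and> y \<in> U \<and> R x y} \<union> {(n + i, n + j) |i j. P i j}\<rparr>"
  have H: "pverts H = h ` U \<union> (+) n ` {..Suc k}"
    "parcs H = {(h x, h y) |x y. x \<in> U \<and> y \<in> U \<and> R x y} \<union> {(n + i, n + j) |i j. P i j}"
    by (simp_all add: H_def)
  have nb1: "nbhd H (h x) = h ` {y \<in> U. R x y}" if "x \<in> U" for x
    using that by (auto simp: nbhd_def H h_eq h_ne)
  have nb2: "nbhd H (n + i) = (+) n ` {j. P i j}" for i
    by (auto simp: nbhd_def H h_ne)
  have graph: "pair_graph H"
  proof
    show "fst e \<in> pverts H" "snd e \<in> pverts H" if "e \<in> parcs H" for e
      using that by (auto simp: H P_def)
    show "finite (pverts H)" by (simp add: H im)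
    then have "finite (pverts H \<times> pverts H)" by simp
    then show "finite (parcs H)" by (rule finite_subset[rotated]) (auto simp: H P_def)
    show "fst e \<noteq> snd e" if "e \<in> parcs H" for e
      using that by (auto simp: H P_def h_eq irrefl)
    have "(w, u) \<in> parcs H" if "(u, w) \<in> parcs H" for u w
      using that sym[THEN iffD1] P_sym unfolding H by blast
    then show "symmetric (with_proj H)" by (auto simp: symmetric_def intro: symI)
  qed
  have quasi: "quasi_line H"
    unfolding quasi_line_def
  proof
    fix w assume "w \<in> pverts H"
    then consider x where "x \<in> U" "w = h x" | i where "i \<le> Suc k" "w = n + i"
      by (auto simp: H)
    then show "\<exists>A B. clique H A \<and> clique H B \<and> nbhd H w \<subseteq> A \<union> B"
    proof cases
      case 1
      let ?N = "{y \<in> U. R x y}"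
      from neighbourhood_two_cliques[OF 1(1)] obtain A where
        A: "\<forall>y\<in>?N. \<forall>z\<in>?N. y \<noteq> z \<longrightarrow> (y \<in> A \<longleftrightarrow> z \<in> A) \<longrightarrow> R y z" ..
      have cl: "clique H (h ` S)" if "S \<subseteq> ?N" "\<And>y z. y \<in> S \<Longrightarrow> z \<in> S \<Longrightarrow> y \<noteq> z \<Longrightarrow> R y z" for S
      proof -
        have "(h y, h z) \<in> parcs H" if "y \<in> S" "z \<in> S" "h y \<noteq> h z" for y z
        proof -
          have "y \<noteq> z" "y \<in> U" "z \<in> U" using that \<open>S \<subseteq> ?N\<close> by auto
          then show ?thesis using \<open>\<And>y z. y \<in> S \<Longrightarrow> z \<in> S \<Longrightarrow> y \<noteq> z \<Longrightarrow> R y z\<close> that unfolding H by blast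
        qed
        moreover have "h ` S \<subseteq> pverts H" using \<open>S \<subseteq> ?N\<close> unfolding H by blast
        ultimately show ?thesis unfolding clique_def by blast
      qed
      have "clique H (h ` (?N \<inter> A))" by (rule cl) (use A in blast)+
      moreover have "clique H (h ` (?N - A))" by (rule cl) (use A in blast)+
      moreover have "nbhd H w \<subseteq> h ` (?N \<inter> A) \<union> h ` (?N - A)"
        using 1 by (auto simp: nb1)
      ultimately show ?thesis by blast
    next
      case 2
      have "clique H ((+) n ` {..4})" "clique H ((+) n ` ({..Suc k} - {1..4}))"
        using k_ge by (auto simp: clique_def H P_def)
      moreover have "nbhd H w \<subseteq> (+) n ` {..4} \<union> (+) n ` ({..Suc k} - {1..4})"
        using 2 by (auto simp: nb2 P_def)
      ultimately show ?thesis by blast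
    qed
  qed
  have degree: "max_degree H = Suc k"
  proof (rule antisym)
    have "card (nbhd H w) \<le> Suc k" if w: "w \<in> pverts H" for w
    proof -
      from w consider x where "x \<in> U" "w = h x" | i where "i \<le> Suc k" "w = n + i"
        by (auto simp: H)
      then show ?thesis
      proof cases
        case 1
        then show ?thesis
          using degree_le[of x] card_image_le[of "{y \<in> U. R x y}" h] finite_U by (simp add: nb1)
      next
        case 2
        have "card {j. P i j} \<le> card ({..Suc k} - {i})" by (rule card_mono) (auto simp: P_def)
        with 2 show ?thesis by (simp add: nb2 card_image)
      qed
    qed
    then show "max_degree H \<le> Suc k"
      unfolding max_degree_def out_degree_eq_card_nbhd using finite_U by (auto simp: H)
    have "{j. P 0 j} = {1..Suc k}" by (auto simp: P_def)
    then have "card (nbhd H (n + 0)) = Suc k" unfolding nb2 by (simp add: card_image)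
    moreover have "n + 0 \<in> pverts H" unfolding H by blast
    ultimately show "Suc k \<le> max_degree H" using card_nbhd_le_max_degree[OF graph] by metis
  qed
  have chromatic: "Suc k \<le> list_chromatic_number H"
  proof (rule ccontr)
    define j where "j = list_chromatic_number H"
    assume "\<not> ?thesis"
    then have "j \<le> k" by (simp add: j_def)
    have "\<exists>B\<subseteq>L x. card B = j" if "x \<in> U" for x
      using lists[OF that] \<open>j \<le> k\<close> by (metis obtain_subset_with_card_n)
    then obtain B where B: "\<And>x. x \<in> U \<Longrightarrow> B x \<subseteq> L x \<and> card (B x) = j" by metis
    then have fin: "finite (B x)" if "x \<in> U" for x using lists that finite_subset by blast
    \<comment> \<open>Choosability concerns lists of size exactly \<open>j\<close>, hence the
      subsets \<open>B x\<close> of \<open>L x\<close>; on the added component any lists of that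
      size serve.\<close>
    define L' where "L' w = (if w < n then B (inv_into U h w) else {..<j})" for w
    have L'h: "L' (h x) = B x" if "x \<in> U" for x
      using that inj hn by (simp add: L'_def)
    have "\<forall>w\<in>pverts H. finite (L' w) \<and> card (L' w) = j"
      using B fin by (auto simp: H L'h) (auto simp: L'_def)
    moreover have "choosable j H"
      unfolding j_def by (rule choosable_list_chromatic_number[OF graph])
    ultimately obtain c where c: "list_coloring H L' c" unfolding choosable_def by blast
    have "c (h x) \<in> L x" if "x \<in> U" for x
      using c B[OF that] L'h[OF that] that unfolding list_coloring_def H by blast
    moreover have "c (h x) \<noteq> c (h y)" if "x \<in> U" "y \<in> U" "R x y" for x y
      using c that unfolding list_coloring_def H by blast
    ultimately have "proper R U L (c \<circ> h)" by (simp add: proper_def)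
    then show False using not_colorable by blast
  qed
  have complete: "\<exists>C\<subseteq>U. card C = Suc k \<and> (\<forall>x\<in>C. \<forall>y\<in>C. x \<noteq> y \<longrightarrow> R x y)"
    if "contains_complete (Suc k) H"
  proof -
    from that obtain D where D: "clique H D" "card D = Suc k"
      using contains_complete_iff_clique[OF graph] by blast
    have adj: "(u, w) \<in> parcs H" if "u \<in> D" "w \<in> D" "u \<noteq> w" for u w
      using D(1) that by (auto simp: clique_def)
    have D_sub: "D \<subseteq> h ` U \<union> (+) n ` {..Suc k}" using D(1) by (simp add: clique_def H)
    \<comment> \<open>A clique lies in one component, and the cliques of the added one are too
      small.\<close>
    show ?thesis
    proof (cases "D \<inter> h ` U = {}")
      case True
      define E where "E = {i. n + i \<in> D}"
      have DE: "D = (+) n ` E" using D_sub True unfolding E_def by blast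
      then have card_E: "card E = Suc k" using D(2) by (simp add: card_image)
      have P: "P i j" if "i \<in> E" "j \<in> E" "i \<noteq> j" for i j
      proof -
        have "n + j \<in> nbhd H (n + i)" using adj[of "n + i" "n + j"] that by (simp add: E_def nbhd_def)
        then show ?thesis unfolding nb2 by auto
      qed
      have E: "E \<subseteq> {..Suc k}"
      proof
        fix i assume "i \<in> E"
        then have "n + i \<in> (+) n ` {..Suc k}" using D_sub True unfolding E_def by blast
        then show "i \<in> {..Suc k}" by auto
      qed
      show ?thesis
      proof (cases "E \<inter> {1..4} = {}")
        case True
        with E have "E \<subseteq> {..Suc k} - {1..4}" by auto
        then have "card E \<le> card ({..Suc k} - {1..4})" by (intro card_mono) auto
        also have "\<dots> = k - 2" using k_ge by (subst card_Diff_subset) auto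
        finally show ?thesis using card_E by simp
      next
        case False
        then obtain i where i: "i \<in> E" "i \<in> {1..4}" by blast
        have "E \<subseteq> {..4}"
        proof
          fix j assume "j \<in> E"
          then show "j \<in> {..4}" using i P[of i j] by (cases "i = j") (auto simp: P_def)
        qed
        then have "card E \<le> card {..4::nat}" by (intro card_mono) auto
        then show ?thesis using card_E k_ge by simp
      qed
    next
      case False
      then obtain x where x: "x \<in> U" "h x \<in> D" by blast
      define C where "C = {y \<in> U. h y \<in> D}"
      have "D \<subseteq> h ` U"
      proof
        fix w assume w: "w \<in> D"
        show "w \<in> h ` U"
        proof (cases "h x = w")
          case False
          then have "w \<in> nbhd H (h x)" using adj[OF x(2) w] by (simp add: nbhd_def)
          then show ?thesis unfolding nb1[OF x(1)] by blast
        qed (use x in blast)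
      qed
      then have DC: "D = h ` C" unfolding C_def by blast
      moreover have "inj_on h C" using inj by (rule inj_on_subset) (auto simp: C_def)
      ultimately have "card C = Suc k" using D(2) by (simp add: card_image)
      moreover have "R y z" if "y \<in> C" "z \<in> C" "y \<noteq> z" for y z
      proof -
        have yz: "y \<in> U" "z \<in> U" "h y \<in> D" "h z \<in> D" using that by (simp_all add: C_def)
        with that(3) have "h z \<in> nbhd H (h y)" using adj[of "h y" "h z"] by (simp add: nbhd_def h_eq)
        with yz show ?thesis by (auto simp: nb1 h_eq)
      qed
      ultimately show ?thesis by (intro exI[of _ C]) (auto simp: C_def)
    qed
  qed
  show ?thesis
    by (rule exI[of _ H], intro conjI impI, fact graph, fact quasi, fact degree, fact chromatic, rule complete)
qed

end

theorem theorem5p6: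
  assumes quasi_line_case:
    "\<And>G :: nat pair_pre_digraph.
       \<lbrakk>pair_graph G; quasi_line G;
        list_chromatic_number G \<ge> max_degree G; max_degree G \<ge> 9\<rbrakk>
       \<Longrightarrow> contains_complete (max_degree G) G"
  fixes G :: "'a pair_pre_digraph"
  assumes "pair_graph G" and "claw_free G"
    and "list_chromatic_number G \<ge> max_degree G" and "max_degree G \<ge> 9"
  shows "contains_complete (max_degree G) G"
proof -
  interpret pair_graph G by (rule assms(2))
  define k where "k = max_degree G - 1"
  have k: "max_degree G = Suc k" "8 \<le> k" using assms(5) by (auto simp: k_def)
  let ?R = "\<lambda>x y. (x, y) \<in> parcs G"
  have "\<not> choosable k G"
    using assms(4) k(1) unfolding list_chromatic_number_def by (intro not_less_Least) simp
  then obtain L :: "'a \<Rightarrow> nat set" where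
    L: "\<And>x. x \<in> pverts G \<Longrightarrow> finite (L x) \<and> card (L x) = k" "\<And>c. \<not> list_coloring G L c"
    unfolding choosable_def by blast
  \<comment> \<open>The lists \<open>L\<close> stay fixed; a vertex set of least size that is not
    colourable from them is critical.\<close>
  let ?bad = "\<lambda>U. U \<subseteq> pverts G \<and> (\<forall>c. \<not> proper ?R U L c)"
  have "?bad (pverts G)"
  proof (intro conjI allI notI)
    fix c assume "proper ?R (pverts G) L c"
    then have "list_coloring G L c"
      unfolding list_coloring_def proper_def using in_arcsD1 in_arcsD2 by fast
    with L(2) show False by blast
  qed simp
  then obtain U where U: "?bad U" "\<And>W. ?bad W \<Longrightarrow> card U \<le> card W"
    using ex_has_least_nat[of ?bad "pverts G" card] by blast
  interpret claw_free_list_critical U ?R L k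
  proof
    show fin: "finite U" using U(1) pair_finite_verts finite_subset by blast
    show "((x, y) \<in> parcs G) = ((y, x) \<in> parcs G)" for x y by (rule sym_parcs[OF assms(2)])
    show "(x, x) \<notin> parcs G" for x using pair_no_loops[of "(x, x)"] by auto
    show "card {y \<in> U. (x, y) \<in> parcs G} \<le> Suc k" if "x \<in> U" for x
    proof -
      have "finite (nbhd G x)"
        by (rule finite_subset[OF _ pair_finite_verts]) (auto simp: nbhd_def dest: in_arcsD2)
      then have "card {y \<in> U. (x, y) \<in> parcs G} \<le> card (nbhd G x)"
        by (rule card_mono) (auto simp: nbhd_def)
      also have "\<dots> \<le> Suc k"
        using card_nbhd_le_max_degree[OF assms(2)] U(1) that k(1) by auto
      finally show ?thesis .
    qed
    show "finite (L x) \<and> card (L x) = k" if "x \<in> U" for x using L(1) U(1) that by blast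
    show "\<not> proper ?R U L c" for c using U(1) by blast
    show "\<exists>c. proper ?R W L c" if "W \<subset> U" for W
    proof (rule ccontr)
      assume "\<not> ?thesis"
      then have "?bad W" using that U(1) by blast
      with U(2) psubset_card_mono[OF fin that] show False by (simp add: leD)
    qed
    show "(a, b) \<in> parcs G \<or> (a, c) \<in> parcs G \<or> (b, c) \<in> parcs G"
      if "(x, a) \<in> parcs G" "(x, b) \<in> parcs G" "(x, c) \<in> parcs G" "distinct [a, b, c]" for x a b c
      by (rule claw_freeD[OF assms(2,3) that(4,1,2,3)])
    show "8 \<le> k" by (rule k(2))
  qed
  from ex_nat_quasi_line_graph obtain H :: "nat pair_pre_digraph" where
    H: "pair_graph H \<and> quasi_line H \<and> max_degree H = Suc k \<and> Suc k \<le> list_chromatic_number H \<and>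
     (contains_complete (Suc k) H \<longrightarrow>
       (\<exists>C\<subseteq>U. card C = Suc k \<and> (\<forall>x\<in>C. \<forall>y\<in>C. x \<noteq> y \<longrightarrow> ?R x y)))" ..
  \<comment> \<open>The assumed quasi-line case applies to \<open>H\<close>; its clique on
    \<open>Suc k\<close> vertices comes from \<open>U\<close> and hence from
    \<open>G\<close>.\<close>
  then have "contains_complete (Suc k) H" using quasi_line_case[of H] k(2) by simp
  with H obtain C where "C \<subseteq> U" "card C = Suc k" "\<forall>x\<in>C. \<forall>y\<in>C. x \<noteq> y \<longrightarrow> ?R x y" by blast
  moreover from this U(1) have "clique G C" unfolding clique_def by blast
  ultimately show ?thesis unfolding k(1) contains_complete_iff_clique[OF assms(2)] by blast
qed

end
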